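(* Let $\mathbf z^{n,w}=\{\mathbf z_\alpha^{n,w}\}_{\alpha\in V\cup\bar E}$ and $\mathbf f_{i,n,w}$ be generated by the distributed Dykstra's algorithm, where the primal problem is feasible, $\bar E_n=[\bigcup_{w=1}^{\bar w}S_{n,w}]\cap\bar E$ and $\bigcup_{w=1}^{\bar w}S_{n,w}\supset V$ for all $n\ge1$, and the assumptions (A1)-(A3) of the context hold. Suppose that a dual optimizer $\mathbf z^*$ (a maximizer of $F$) exists, and that the dual iterates $\{\mathbf z_\alpha^{n,w}\}$ are bounded for all $\alpha\in V\cup\bar E$, $w\in\{1,\dots,\bar w\}$ and $n\ge1$. Let $$h^n=-F^{n,0}(\mathbf z^{n,0})-(-F(\mathbf z^* )).$$ Then there is some $\gamma>0$ such that for all $n\ge 1$ $$h^{n+2}\le h^n-\gamma\,[h^{n+2}]^4,$$ and consequently the dual function value converges at a rate of $O(1/n^{1/3})$, i.e. $h^n=O(1/n^{1/3})$. Moreover, if $V_4=\emptyset$, then there is some $C_1>0$ such that $h^{n+1}\le C_1\sqrt{\bar w}\sqrt{h^n-h^{n+1}}$ for all $n\ge1$, and consequently the dual function value converges at a rate of $O(1/n)$, i.e. $h^n=O(1/n)$.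
   Context: **Problem.** $V,\bar E$ are finite disjoint sets and $\mathbf X=\prod_{i\in V}X_i$ with each $X_i$ a finite dimensional Hilbert space; $[\mathbf x]_i\in X_i$ is the $i$-th component of $\mathbf x\in\mathbf X$. For $i\in V$, $f_i:X_i\to\mathbb R\cup\{\infty\}$ is closed convex and $\mathbf f_i(\mathbf x)=f_i([\mathbf x]_i)$. For $\alpha\in\bar E$, $H_\alpha\subset\mathbf X$ is a linear subspace and $\mathbf f_\alpha=\delta_{H_\alpha}$ (indicator function). Fix $\bar{\mathbf x}\in\mathbf X$. The primal problem is $\min_{\mathbf x\in\mathbf X}\frac12\|\mathbf x-\bar{\mathbf x}\|^2+\sum_{\alpha\in V\cup\bar E}\mathbf f_\alpha(\mathbf x)$. The set $V$ is a disjoint union $V_1\cup V_2\cup V_3\cup V_4$: for $i\in V_1$, $f_i$ is proximable (its proximal subproblems can be solved); for $i\in V_2$, $f_i$ is the indicator function of a closed convex set; for $i\in V_3$, $f_i$ is proximable with $\mathrm{dom}(f_i)=X_i$; for $i\in V_4$, $\mathrm{dom}(f_i)=X_i$ and $f_i$ is accessed through subgradients (no smoothness is assumed). $^*$ denotes Fenchel conjugate. **Dual functions.** The dual problem is to maximize over $\mathbf z=\{\mathbf z_\alpha\}_{\alpha\in V\cup\bar E}\in\mathbf X^{|V\cup\bar E|}$ the function $F(\mathbf z)=-\frac12\|\bar{\mathbf x}-\sum_{\alpha\in\bar E\cup V}\mathbf z_\alpha\|^2+\frac12\|\bar{\mathbf x}\|^2-\sum_{\alpha\in\bar E\cup V}\mathbf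 f_\alpha^*(\mathbf z_\alpha)$, and $F^{n,w}(\mathbf z)=-\frac12\|\bar{\mathbf x}-\sum_{\alpha\in\bar E\cup V}\mathbf z_\alpha\|^2+\frac12\|\bar{\mathbf x}\|^2-\sum_{\alpha\in\bar E\cup V}\mathbf f_{\alpha,n,w}^*(\mathbf z_\alpha)$, with $\mathbf f_{\alpha,n,w}$ from the algorithm below. **Connecting sets.** $D=\bigcap_{\alpha\in\bar E}H_\alpha$. A subset $E'\subset\bar E$ connects $V$ if $\bigcap_{\alpha\in E'}H_\alpha=D$. $C_{reg}>0$ is a constant such that for all $\mathbf v\in D^\perp$ and all $E'$ connecting $V$ one can write $\mathbf v=\sum_{\alpha\in E'}\mathbf v_\alpha$ with $\mathbf v_\alpha\in H_\alpha^\perp$ and $\|\mathbf v_\alpha\|\le C_{reg}\|\mathbf v\|$ (such a constant exists). **Distributed Dykstra's algorithm.** $\bar w$ is a fixed positive integer. For $\alpha\in(\bar E\cup V)\setminus V_4$ put $\mathbf f_{\alpha,n,w}=\mathbf f_\alpha$ for all $n,w$. Write $\mathbf v_H^{n,w}=\sum_{\alpha\in\bar E}\mathbf z_\alpha^{n,w}$, $\mathbf v_A^{n,w}=\mathbf v_H^{n,w}+\sum_{i\in V}\mathbf z_i^{n,w}$, $\mathbf x^{n,w}=\bar{\mathbf x}-\mathbf v_A^{n,w}$. Initialization: choose $\mathbf z_i^{1,0}\in\mathbf X$ with $[\mathbf z_i^{1,0}]_j=0$ for $j\ne i$ ($i\in V$); $\mathbf v_H^{1,0}\in D^\perp$; and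 for $i\in V_4$ a convex function $f_{i,1,0}:X_i\to\mathbb R$ with $f_{i,1,0}\le f_i$, and $\mathbf f_{i,1,0}(\mathbf x)=f_{i,1,0}([\mathbf x]_i)$. For $n=1,2,\dots$: (a) Choose $\bar E_n\subset\bar E$ that connects $V$, and choose $\{\mathbf z_\alpha^{n,0}\}_{\alpha\in\bar E}$ with $\mathbf z_\alpha^{n,0}=0$ for $\alpha\notin\bar E_n$, $\mathbf z_\alpha^{n,0}\in H_\alpha^\perp$ and $\|\mathbf z_\alpha^{n,0}\|\le C_{reg}\|\mathbf v_H^{n,0}\|$ for all $\alpha\in\bar E$, and $\sum_{\alpha\in\bar E}\mathbf z_\alpha^{n,0}=\mathbf v_H^{n,0}$. (b) For $w=1,\dots,\bar w$: choose a nonempty $S_{n,w}\subset\bar E_n\cup V$. - If $S_{n,w}\subset V_4$: for each $i\in S_{n,w}$ let $q=[\bar{\mathbf x}-\mathbf v_H^{n,w-1}-\mathbf z_i^{n,w-1}]_i$, choose $s\in\partial f_i(q)$, let $\tilde f_{i,n,w-1}(x)=f_i(q)+\langle s,x-q\rangle$, let $x_i^+$ be the minimizer over $x\in X_i$ of $\frac12\|[\bar{\mathbf x}-\mathbf v_H^{n,w-1}]_i-x\|^2+\max\{f_{i,n,w-1},\tilde f_{i,n,w-1}\}(x)$, and $z_i^+=[\bar{\mathbf x}-\mathbf v_H^{n,w-1}]_i-x_i^+$ the corresponding dual solution. Set $f_{i,n,w}(x)=\max\{f_{i,n,w-1},\tilde f_{i,n,w-1}\}(x_i^+)+\langle x-x_i^+,z_i^+\rangle$,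 $\mathbf f_{i,n,w}(\mathbf x)=f_{i,n,w}([\mathbf x]_i)$, $[\mathbf z_i^{n,w}]_i=z_i^+$ and $[\mathbf z_i^{n,w}]_j=0$ for $j\ne i$. For $i\in V_4\setminus S_{n,w}$ set $\mathbf f_{i,n,w}=\mathbf f_{i,n,w-1}$. - Otherwise: set $\mathbf f_{i,n,w}=\mathbf f_{i,n,w-1}$ for all $i\in V_4$, and let $\{\mathbf z_\alpha^{n,w}\}_{\alpha\in S_{n,w}}$ be a minimizer of $\frac12\|\bar{\mathbf x}-\sum_{\alpha\notin S_{n,w}}\mathbf z_\alpha^{n,w-1}-\sum_{\alpha\in S_{n,w}}\mathbf z_\alpha\|^2+\sum_{\alpha\in S_{n,w}}\mathbf f_{\alpha,n,w}^*(\mathbf z_\alpha)$. In both cases $\mathbf z_\alpha^{n,w}=\mathbf z_\alpha^{n,w-1}$ for $\alpha\notin S_{n,w}$. (c) Set $\mathbf z_i^{n+1,0}=\mathbf z_i^{n,\bar w}$ ($i\in V$), $\mathbf v_H^{n+1,0}=\mathbf v_H^{n,\bar w}$, and $\mathbf f_{i,n+1,0}=\mathbf f_{i,n,\bar w}$ ($i\in V_4$). **Assumptions on the algorithm.** Let $p(n,\alpha)=\max\{w'\le\bar w:\alpha\in S_{n,w'}\}$. (A1) Whenever $w>1$ and $S_{n,w}\subset V_4$, for each $i\in V_4$ the vector $[\mathbf z_i^{n,w-1}]_i$ is the minimizer over $z\in X_i$ of $\frac12\|[\bar{\mathbf x}-\mathbf v_H^{n,w-1}]_i-z\|^2+f_{i,n,w-1}^*(z)$;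 in other words, if $w_i$ is the last index $w'\in\{1,\dots,w-1\}$ with $i\in S_{n,w'}$, then for all $\tilde w\in\{w_i+1,\dots,w-1\}$ and $\alpha\in S_{n,\tilde w}\cap\bar E$, $\mathbf v\in H_\alpha^\perp$ implies $[\mathbf v]_i=0$. (A2) For all $i\in V_4$, $\tilde w\in\{p(n,i)+1,\dots,\bar w\}$ and $\alpha\in S_{n,\tilde w}\cap\bar E$, $\mathbf v\in H_\alpha^\perp$ implies $[\mathbf v]_i=0$. (A3) If $V_4\neq\emptyset$, then $S_{n,1}=V_4$ for all $n>1$. *)

theory Defs
  imports "HOL-Analysis.Analysis" "HOL-Library.Landau_Symbols"
begin

section \<open>Extended-real-valued convex analysis relative to a subspace\<close>

text \<open>
  Functions with values in the extended reals live on a linear subspace \<open>X\<close> of a Euclidean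
  space (an arbitrary finite dimensional Hilbert space); their values outside \<open>X\<close> are irrelevant.
\<close>

definition closed_convex_fun :: "'b::euclidean_space set \<Rightarrow> ('b \<Rightarrow> ereal) \<Rightarrow> bool" where
  "closed_convex_fun X f \<longleftrightarrow>
     (\<forall>x\<in>X. f x \<noteq> -\<infinity>) \<and>
     closed {(x, t :: real). x \<in> X \<and> f x \<le> ereal t} \<and>
     convex {(x, t :: real). x \<in> X \<and> f x \<le> ereal t}"

definition ind_fun :: "'b set \<Rightarrow> 'b \<Rightarrow> ereal" where
  "ind_fun A x = (if x \<in> A then 0 else \<infinity>)"

definition conjugate :: "'b::real_inner set \<Rightarrow> ('b \<Rightarrow> ereal) \<Rightarrow> 'b \<Rightarrow> ereal" where
  "conjugate X f z = (SUP x\<in>X. ereal (z \<bullet> x) - f x)"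

definition subdifferential :: "'b::real_inner set \<Rightarrow> ('b \<Rightarrow> ereal) \<Rightarrow> 'b \<Rightarrow> 'b set" where
  "subdifferential X f q = {s \<in> X. \<forall>y\<in>X. f q + ereal (s \<bullet> (y - q)) \<le> f y}"

text \<open>Solvability of all proximal subproblems.  For closed convex functions it is automatic; it is
  stated only because it is part of the description of the nodes.\<close>

definition proximable :: "'b::real_inner set \<Rightarrow> ('b \<Rightarrow> ereal) \<Rightarrow> bool" where
  "proximable X f \<longleftrightarrow>
     (\<forall>u\<in>X. \<exists>x. is_arg_min (\<lambda>x. ereal ((norm (x - u))\<^sup>2 / 2) + f x) (\<lambda>x. x \<in> X) x)"

definition ereal_sqrt :: "ereal \<Rightarrow> ereal" where
  "ereal_sqrt x = (if \<bar>x\<bar> = \<infinity> then x else ereal (sqrt (real_of_ereal x)))"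

text \<open>\<open>h = O(r)\<close> for an extended-real sequence: finitely many terms may be infinite.\<close>

definition ereal_bigo :: "(nat \<Rightarrow> ereal) \<Rightarrow> (nat \<Rightarrow> real) \<Rightarrow> bool" where
  "ereal_bigo h r \<longleftrightarrow>
     (\<forall>\<^sub>F n in sequentially. \<bar>h n\<bar> \<noteq> \<infinity>) \<and> (\<lambda>n. real_of_ereal (h n)) \<in> O(r)"


section \<open>The primal and dual problems\<close>

text \<open>
  The sets \<open>nodes\<close> (\<open>V\<close>) and \<open>edges\<close> (the set \<open>E\<close> with a bar) are disjoint subsets of one finite
  index type \<open>'k\<close>.  The spaces \<open>node_space i\<close> (\<open>X\<^sub>i\<close>) are subspaces of a common Euclidean space
  \<open>'a\<close>, so that they can have different dimensions.  The product of the \<open>X\<^sub>i\<close> over the nodes is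
  \<open>Xprod\<close>, a subspace of \<open>'a ^ 'k\<close> in which the coordinates not belonging to a node vanish.
\<close>

record ('k, 'a) problem =
  nodes :: "'k set"
  nodes1 :: "'k set"
  nodes2 :: "'k set"
  nodes3 :: "'k set"
  nodes4 :: "'k set"
  edges :: "'k set"
  node_space :: "'k \<Rightarrow> 'a set"
  nodefun :: "'k \<Rightarrow> 'a \<Rightarrow> ereal"
  hyper :: "'k \<Rightarrow> ('a ^ 'k) set"
  xbar :: "'a ^ 'k"

definition Xprod :: "('k::finite, 'a::euclidean_space) problem \<Rightarrow> ('a ^ 'k) set" where
  "Xprod P = {x. (\<forall>i\<in>nodes P. x $ i \<in> node_space P i) \<and> (\<forall>i. i \<notin> nodes P \<longrightarrow> x $ i = 0)}"

definition problem_data :: "('k::finite, 'a::euclidean_space) problem \<Rightarrow> bool" where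
  "problem_data P \<longleftrightarrow>
     nodes P \<inter> edges P = {} \<and>
     nodes P = nodes1 P \<union> nodes2 P \<union> nodes3 P \<union> nodes4 P \<and>
     nodes1 P \<inter> nodes2 P = {} \<and> nodes1 P \<inter> nodes3 P = {} \<and> nodes1 P \<inter> nodes4 P = {} \<and>
     nodes2 P \<inter> nodes3 P = {} \<and> nodes2 P \<inter> nodes4 P = {} \<and> nodes3 P \<inter> nodes4 P = {} \<and>
     (\<forall>i\<in>nodes P. subspace (node_space P i)) \<and>
     (\<forall>i\<in>nodes P. closed_convex_fun (node_space P i) (nodefun P i)) \<and>
     (\<forall>i\<in>nodes1 P. proximable (node_space P i) (nodefun P i)) \<and>
     (\<forall>i\<in>nodes2 P. \<exists>C. C \<subseteq> node_space P i \<and> closed C \<and> convex C \<and>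
        (\<forall>x\<in>node_space P i. nodefun P i x = ind_fun C x)) \<and>
     (\<forall>i\<in>nodes3 P. proximable (node_space P i) (nodefun P i) \<and>
        (\<forall>x\<in>node_space P i. nodefun P i x < \<infinity>)) \<and>
     (\<forall>i\<in>nodes4 P. \<forall>x\<in>node_space P i. nodefun P i x < \<infinity>) \<and>
     (\<forall>\<alpha>\<in>edges P. subspace (hyper P \<alpha>) \<and> hyper P \<alpha> \<subseteq> Xprod P) \<and>
     xbar P \<in> Xprod P"

definition bf :: "('k::finite, 'a::euclidean_space) problem \<Rightarrow> 'k \<Rightarrow> 'a ^ 'k \<Rightarrow> ereal" where
  "bf P \<alpha> x = (if \<alpha> \<in> nodes P then nodefun P \<alpha> (x $ \<alpha>) else ind_fun (hyper P \<alpha>) x)"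

definition primal :: "('k::finite, 'a::euclidean_space) problem \<Rightarrow> 'a ^ 'k \<Rightarrow> ereal" where
  "primal P x = ereal ((norm (x - xbar P))\<^sup>2 / 2) + (\<Sum>\<alpha>\<in>nodes P \<union> edges P. bf P \<alpha> x)"

definition feasible :: "('k::finite, 'a::euclidean_space) problem \<Rightarrow> bool" where
  "feasible P \<longleftrightarrow> (\<exists>x\<in>Xprod P. primal P x < \<infinity>)"

text \<open>The dual function built from an arbitrary family \<open>\<phi>\<close> in place of the functions
  \<open>bf P \<alpha>\<close>.\<close>

definition dual_of ::
  "('k::finite, 'a::euclidean_space) problem \<Rightarrow> ('k \<Rightarrow> 'a ^ 'k \<Rightarrow> ereal) \<Rightarrow> ('k \<Rightarrow> 'a ^ 'k) \<Rightarrow> ereal"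
  where
  "dual_of P \<phi> z =
     ereal (- (norm (xbar P - (\<Sum>\<alpha>\<in>edges P \<union> nodes P. z \<alpha>)))\<^sup>2 / 2 + (norm (xbar P))\<^sup>2 / 2)
     - (\<Sum>\<alpha>\<in>edges P \<union> nodes P. conjugate (Xprod P) (\<phi> \<alpha>) (z \<alpha>))"

abbreviation dual :: "('k::finite, 'a::euclidean_space) problem \<Rightarrow> ('k \<Rightarrow> 'a ^ 'k) \<Rightarrow> ereal" where
  "dual P \<equiv> dual_of P (bf P)"

definition dual_optimizer ::
  "('k::finite, 'a::euclidean_space) problem \<Rightarrow> ('k \<Rightarrow> 'a ^ 'k) \<Rightarrow> bool" where
  "dual_optimizer P z \<longleftrightarrow>
     (\<forall>\<alpha>\<in>nodes P \<union> edges P. z \<alpha> \<in> Xprod P) \<and>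
     (\<forall>y. (\<forall>\<alpha>\<in>nodes P \<union> edges P. y \<alpha> \<in> Xprod P) \<longrightarrow> dual P y \<le> dual P z)"


section \<open>Connecting sets\<close>

text \<open>Orthogonal complements are taken inside the product space.\<close>

definition perp ::
  "('k::finite, 'a::euclidean_space) problem \<Rightarrow> ('a ^ 'k) set \<Rightarrow> ('a ^ 'k) set" where
  "perp P A = Xprod P \<inter> A\<^sup>\<bottom>"

definition Hcap :: "('k::finite, 'a::euclidean_space) problem \<Rightarrow> 'k set \<Rightarrow> ('a ^ 'k) set" where
  "Hcap P E' = Xprod P \<inter> (\<Inter>\<alpha>\<in>E'. hyper P \<alpha>)"

abbreviation Dspace :: "('k::finite, 'a::euclidean_space) problem \<Rightarrow> ('a ^ 'k) set" where
  "Dspace P \<equiv> Hcap P (edges P)"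

definition connects :: "('k::finite, 'a::euclidean_space) problem \<Rightarrow> 'k set \<Rightarrow> bool" where
  "connects P E' \<longleftrightarrow> E' \<subseteq> edges P \<and> Hcap P E' = Dspace P"

definition regularity_const ::
  "('k::finite, 'a::euclidean_space) problem \<Rightarrow> real \<Rightarrow> bool" where
  "regularity_const P C \<longleftrightarrow> C > 0 \<and>
     (\<forall>v \<in> perp P (Dspace P). \<forall>E'. connects P E' \<longrightarrow>
        (\<exists>u. v = (\<Sum>\<alpha>\<in>E'. u \<alpha>) \<and>
             (\<forall>\<alpha>\<in>E'. u \<alpha> \<in> perp P (hyper P \<alpha>) \<and> norm (u \<alpha>) \<le> C * norm v)))"


section \<open>The distributed Dykstra algorithm\<close>

text \<open>
  A run consists of the dual vectors \<open>z n w \<alpha>\<close>, the minorants \<open>g n w i\<close> (the functions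
  \<open>f\<^sub>i\<^sub>,\<^sub>n\<^sub>,\<^sub>w\<close> for \<open>i\<close> in \<open>nodes4\<close>), the index sets \<open>S n w\<close> and the edge sets \<open>En n\<close>, where
  \<open>n \<ge> 1\<close>, and \<open>w\<close> ranges over \<open>0..wbar\<close> for \<open>z\<close> and \<open>g\<close> and over \<open>1..wbar\<close> for \<open>S\<close>.
\<close>

definition bfn ::
  "('k::finite, 'a::euclidean_space) problem \<Rightarrow> (nat \<Rightarrow> nat \<Rightarrow> 'k \<Rightarrow> 'a \<Rightarrow> real)
     \<Rightarrow> nat \<Rightarrow> nat \<Rightarrow> 'k \<Rightarrow> 'a ^ 'k \<Rightarrow> ereal" where
  "bfn P g n w \<alpha> = (if \<alpha> \<in> nodes4 P then (\<lambda>x. ereal (g n w \<alpha> (x $ \<alpha>))) else bf P \<alpha>)"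

abbreviation dualn ::
  "('k::finite, 'a::euclidean_space) problem \<Rightarrow> (nat \<Rightarrow> nat \<Rightarrow> 'k \<Rightarrow> 'a \<Rightarrow> real)
     \<Rightarrow> nat \<Rightarrow> nat \<Rightarrow> ('k \<Rightarrow> 'a ^ 'k) \<Rightarrow> ereal" where
  "dualn P g n w \<equiv> dual_of P (bfn P g n w)"

definition vH ::
  "('k::finite, 'a::euclidean_space) problem \<Rightarrow> (nat \<Rightarrow> nat \<Rightarrow> 'k \<Rightarrow> 'a ^ 'k)
     \<Rightarrow> nat \<Rightarrow> nat \<Rightarrow> 'a ^ 'k" where
  "vH P z n w = (\<Sum>\<alpha>\<in>edges P. z n w \<alpha>)"

definition initialization ::
  "('k::finite, 'a::euclidean_space) problem \<Rightarrow> (nat \<Rightarrow> nat \<Rightarrow> 'k \<Rightarrow> 'a ^ 'k)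
     \<Rightarrow> (nat \<Rightarrow> nat \<Rightarrow> 'k \<Rightarrow> 'a \<Rightarrow> real) \<Rightarrow> bool" where
  "initialization P z g \<longleftrightarrow>
     (\<forall>i\<in>nodes P. z 1 0 i \<in> Xprod P \<and> (\<forall>j. j \<noteq> i \<longrightarrow> z 1 0 i $ j = 0)) \<and>
     vH P z 1 0 \<in> perp P (Dspace P) \<and>
     (\<forall>i\<in>nodes4 P. convex_on (node_space P i) (g 1 0 i) \<and>
        (\<forall>x\<in>node_space P i. ereal (g 1 0 i x) \<le> nodefun P i x))"

text \<open>That the vectors \<open>z n 0 \<alpha>\<close> sum to \<open>vH P z n 0\<close> over the edges is the definition of
  \<open>vH\<close>.\<close>

definition edge_step ::
  "('k::finite, 'a::euclidean_space) problem \<Rightarrow> real \<Rightarrow> (nat \<Rightarrow> nat \<Rightarrow> 'k \<Rightarrow> 'a ^ 'k)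
     \<Rightarrow> (nat \<Rightarrow> 'k set) \<Rightarrow> nat \<Rightarrow> bool" where
  "edge_step P Creg z En n \<longleftrightarrow>
     connects P (En n) \<and>
     (\<forall>\<alpha>\<in>edges P - En n. z n 0 \<alpha> = 0) \<and>
     (\<forall>\<alpha>\<in>edges P. z n 0 \<alpha> \<in> perp P (hyper P \<alpha>) \<and> norm (z n 0 \<alpha>) \<le> Creg * norm (vH P z n 0))"

definition subgradient_update ::
  "('k::finite, 'a::euclidean_space) problem \<Rightarrow> (nat \<Rightarrow> nat \<Rightarrow> 'k \<Rightarrow> 'a ^ 'k)
     \<Rightarrow> (nat \<Rightarrow> nat \<Rightarrow> 'k \<Rightarrow> 'a \<Rightarrow> real) \<Rightarrow> nat \<Rightarrow> nat \<Rightarrow> 'k \<Rightarrow> bool" where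
  "subgradient_update P z g n w i \<longleftrightarrow>
     (let c = (xbar P - vH P z n (w - 1)) $ i;
          q = (xbar P - vH P z n (w - 1) - z n (w - 1) i) $ i
      in \<exists>s \<in> subdifferential (node_space P i) (nodefun P i) q. \<exists>xp.
           let m = (\<lambda>x. max (g n (w - 1) i x) (real_of_ereal (nodefun P i q) + s \<bullet> (x - q)));
               zp = c - xp
           in is_arg_min (\<lambda>x. (norm (c - x))\<^sup>2 / 2 + m x) (\<lambda>x. x \<in> node_space P i) xp \<and>
              (\<forall>x\<in>node_space P i. g n w i x = m xp + (x - xp) \<bullet> zp) \<and>
              z n w i $ i = zp \<and> (\<forall>j. j \<noteq> i \<longrightarrow> z n w i $ j = 0))"

definition block_update ::
  "('k::finite, 'a::euclidean_space) problem \<Rightarrow> (nat \<Rightarrow> nat \<Rightarrow> 'k \<Rightarrow> 'a ^ 'k)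
     \<Rightarrow> (nat \<Rightarrow> nat \<Rightarrow> 'k \<Rightarrow> 'a \<Rightarrow> real) \<Rightarrow> (nat \<Rightarrow> nat \<Rightarrow> 'k set) \<Rightarrow> nat \<Rightarrow> nat \<Rightarrow> bool" where
  "block_update P z g S n w \<longleftrightarrow>
     is_arg_min
       (\<lambda>u. ereal ((norm (xbar P - (\<Sum>\<alpha>\<in>(nodes P \<union> edges P) - S n w. z n (w - 1) \<alpha>)
                                  - (\<Sum>\<alpha>\<in>S n w. u \<alpha>)))\<^sup>2 / 2)
            + (\<Sum>\<alpha>\<in>S n w. conjugate (Xprod P) (bfn P g n w \<alpha>) (u \<alpha>)))
       (\<lambda>u. \<forall>\<alpha>\<in>S n w. u \<alpha> \<in> Xprod P)
       (z n w)"

text \<open>On the spaces \<open>node_space P i\<close> an unchanged minorant agrees with its predecessor.\<close>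

definition inner_step ::
  "('k::finite, 'a::euclidean_space) problem \<Rightarrow> (nat \<Rightarrow> nat \<Rightarrow> 'k \<Rightarrow> 'a ^ 'k)
     \<Rightarrow> (nat \<Rightarrow> nat \<Rightarrow> 'k \<Rightarrow> 'a \<Rightarrow> real) \<Rightarrow> (nat \<Rightarrow> nat \<Rightarrow> 'k set) \<Rightarrow> (nat \<Rightarrow> 'k set)
     \<Rightarrow> nat \<Rightarrow> nat \<Rightarrow> bool" where
  "inner_step P z g S En n w \<longleftrightarrow>
     S n w \<noteq> {} \<and> S n w \<subseteq> En n \<union> nodes P \<and>
     (if S n w \<subseteq> nodes4 P
      then (\<forall>i\<in>S n w. subgradient_update P z g n w i) \<and>
           (\<forall>i\<in>nodes4 P - S n w. \<forall>x\<in>node_space P i. g n w i x = g n (w - 1) i x)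
      else (\<forall>i\<in>nodes4 P. \<forall>x\<in>node_space P i. g n w i x = g n (w - 1) i x) \<and>
           block_update P z g S n w) \<and>
     (\<forall>\<alpha>\<in>(nodes P \<union> edges P) - S n w. z n w \<alpha> = z n (w - 1) \<alpha>)"

definition carry_over ::
  "('k::finite, 'a::euclidean_space) problem \<Rightarrow> nat \<Rightarrow> (nat \<Rightarrow> nat \<Rightarrow> 'k \<Rightarrow> 'a ^ 'k)
     \<Rightarrow> (nat \<Rightarrow> nat \<Rightarrow> 'k \<Rightarrow> 'a \<Rightarrow> real) \<Rightarrow> nat \<Rightarrow> bool" where
  "carry_over P wbar z g n \<longleftrightarrow>
     (\<forall>i\<in>nodes P. z (n + 1) 0 i = z n wbar i) \<and>
     vH P z (n + 1) 0 = vH P z n wbar \<and>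
     (\<forall>i\<in>nodes4 P. \<forall>x\<in>node_space P i. g (n + 1) 0 i x = g n wbar i x)"

definition dykstra_run ::
  "('k::finite, 'a::euclidean_space) problem \<Rightarrow> nat \<Rightarrow> real \<Rightarrow> (nat \<Rightarrow> nat \<Rightarrow> 'k \<Rightarrow> 'a ^ 'k)
     \<Rightarrow> (nat \<Rightarrow> nat \<Rightarrow> 'k \<Rightarrow> 'a \<Rightarrow> real) \<Rightarrow> (nat \<Rightarrow> nat \<Rightarrow> 'k set) \<Rightarrow> (nat \<Rightarrow> 'k set) \<Rightarrow> bool" where
  "dykstra_run P wbar Creg z g S En \<longleftrightarrow>
     initialization P z g \<and>
     (\<forall>n\<ge>1. edge_step P Creg z En n \<and>
            (\<forall>w\<in>{1..wbar}. inner_step P z g S En n w) \<and>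
            carry_over P wbar z g n)"


section \<open>Assumptions on the schedule\<close>

definition last_index :: "nat \<Rightarrow> (nat \<Rightarrow> nat \<Rightarrow> 'k set) \<Rightarrow> nat \<Rightarrow> 'k \<Rightarrow> nat" where
  "last_index wbar S n \<alpha> = Max {w. 1 \<le> w \<and> w \<le> wbar \<and> \<alpha> \<in> S n w}"

definition assumption_A1 ::
  "('k::finite, 'a::euclidean_space) problem \<Rightarrow> nat \<Rightarrow> (nat \<Rightarrow> nat \<Rightarrow> 'k \<Rightarrow> 'a ^ 'k)
     \<Rightarrow> (nat \<Rightarrow> nat \<Rightarrow> 'k \<Rightarrow> 'a \<Rightarrow> real) \<Rightarrow> (nat \<Rightarrow> nat \<Rightarrow> 'k set) \<Rightarrow> bool" where
  "assumption_A1 P wbar z g S \<longleftrightarrow>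
     (\<forall>n\<ge>1. \<forall>w. 1 < w \<and> w \<le> wbar \<and> S n w \<subseteq> nodes4 P \<longrightarrow>
        (\<forall>i\<in>nodes4 P.
           is_arg_min
             (\<lambda>u. ereal ((norm ((xbar P - vH P z n (w - 1)) $ i - u))\<^sup>2 / 2)
                  + conjugate (node_space P i) (\<lambda>x. ereal (g n (w - 1) i x)) u)
             (\<lambda>u. u \<in> node_space P i)
             (z n (w - 1) i $ i)))"

definition assumption_A2 ::
  "('k::finite, 'a::euclidean_space) problem \<Rightarrow> nat \<Rightarrow> (nat \<Rightarrow> nat \<Rightarrow> 'k set) \<Rightarrow> bool" where
  "assumption_A2 P wbar S \<longleftrightarrow>
     (\<forall>n\<ge>1. \<forall>i\<in>nodes4 P. \<forall>w\<in>{last_index wbar S n i + 1..wbar}. \<forall>\<alpha>\<in>S n w \<inter> edges P.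
        \<forall>v \<in> perp P (hyper P \<alpha>). v $ i = 0)"

definition assumption_A3 ::
  "('k::finite, 'a::euclidean_space) problem \<Rightarrow> (nat \<Rightarrow> nat \<Rightarrow> 'k set) \<Rightarrow> bool" where
  "assumption_A3 P S \<longleftrightarrow> (nodes4 P \<noteq> {} \<longrightarrow> (\<forall>n>1. S n 1 = nodes4 P))"

end

theory Submission
  imports Defs
begin

text \<open>
  Write \<open>x n w\<close> for \<open>xbar\<close> minus the sum of all dual vectors.  The negated dual function is
  \<open>\<parallel>x\<parallel>\<^sup>2 / 2\<close> plus a sum of conjugates, up to a constant, and the proof compares its decrease
  along the algorithm with its distance \<open>h\<close> to the optimal value.

  After an update, \<open>x n w\<close> is a subgradient of the conjugate of every updated block at its new dual
  vector; the affine function that this gives also lies below the conjugate from before the update,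
  even when the minorant was replaced (\<open>block_step\<close>, \<open>subgradient_step\<close>).  As the quadratic part
  is strongly convex in \<open>x\<close>, the negated dual value drops in each update by at least
  \<open>\<parallel>x n w - x n (w - 1)\<parallel>\<^sup>2 / 2\<close> (\<open>descent_slack\<close>, \<open>descent_step\<close>).

  At the end of a sweep every dual vector that was updated still satisfies the subgradient inequality
  of the iterate at which it was last updated, and that iterate is within the length \<open>T\<close> of the sweep's path from the final one.  The edge part of a
  dual maximizer can be redistributed over the edges used in the sweep with bounded norms, so adding the
  subgradient inequalities at this maximizer gives \<open>h (n + 1) \<le> M T + (sum of \<epsilon> i over nodes4)\<close>,
  where \<open>\<epsilon> i\<close> is the error of the minorant of node \<open>i\<close> at the current point
  (\<open>comparison_with_optimizer\<close>).  By Cauchy-Schwarz and the descent, \<open>T\<close> is at most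
  \<open>sqrt (2 wbar (h n - h (n + 1)))\<close>; without nodes in \<open>nodes4\<close> this is the claimed inequality.

  The errors \<open>\<epsilon> i\<close> are controlled by the first step of the next sweep.  By \<open>assumption_A2\<close>, the minorant of node
  \<open>i\<close> and its conjugate satisfy the Fenchel-Young equality at the current point \<open>q\<close> and dual vector
  (\<open>contact_at_end\<close>), and by \<open>assumption_A3\<close> the next step linearizes \<open>nodefun P i\<close> at this very point \<open>q\<close>.
  If that step moves \<open>x\<close> by \<open>t\<close> and lowers the negated dual value by \<open>\<delta>\<close>, then
  \<open>t\<^sup>2 / 2 \<le> \<delta>\<close>, while the new linear piece, which lies \<open>\<epsilon> i\<close> above the minorant at \<open>q\<close>,
  forces \<open>\<epsilon> i - L t \<le> \<delta>\<close>, where \<open>L\<close> bounds the slopes (\<open>minorant_gap_le_descent\<close>).  Hence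
  \<open>\<epsilon> i\<close> is of order \<open>sqrt \<delta>\<close>, and \<open>\<delta> \<le> h (n + 1) - h (n + 2)\<close>.

  Together, \<open>(h (n + 2))\<^sup>2 \<le> K (h n - h (n + 2))\<close> (\<open>two_sweep_bound\<close>).  As \<open>h\<close> is bounded from
  the second sweep on, this implies the inequality with the fourth power; and it gives \<open>h = O(1/n)\<close>
  (\<open>two_step_quadratic_decrease_rate\<close>), which is stronger than \<open>O(1/n powr (1/3))\<close>.  Only \<open>h 1\<close> can be
  infinite, since every node is updated in the first sweep, and the inequalities that involve an
  infinite \<open>h 1\<close> are trivial.
\<close>

section \<open>Conjugates\<close>

lemma conjugate_ge: "x \<in> X \<Longrightarrow> ereal (z \<bullet> x) - f x \<le> conjugate X f z"
  unfolding conjugate_def by (rule SUP_upper)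

lemma conjugate_le: "(\<And>x. x \<in> X \<Longrightarrow> ereal (z \<bullet> x) - f x \<le> b) \<Longrightarrow> conjugate X f z \<le> b"
  unfolding conjugate_def by (rule SUP_least)

lemma conjugate_cong: "(\<And>x. x \<in> X \<Longrightarrow> f x = f' x) \<Longrightarrow> conjugate X f z = conjugate X f' z"
  unfolding conjugate_def by (rule SUP_cong) auto

lemma conjugate_antimono:
  assumes "\<And>x. x \<in> X \<Longrightarrow> f x \<le> f' x"
  shows "conjugate X f' z \<le> conjugate X f z"
  unfolding conjugate_def by (rule SUP_mono) (use assms in \<open>blast intro: ereal_minus_mono\<close>)

lemma conjugate_not_MInf:
  assumes "x \<in> X" "f x \<noteq> \<infinity>"
  shows "conjugate X f z \<noteq> -\<infinity>"
  using conjugate_ge[OF assms(1), of z f] assms(2) by (cases "f x") auto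

lemma conjugate_convex:
  assumes fin: "conjugate X f a = ereal A" "conjugate X f b = ereal B"
    and t: "0 \<le> t" "t \<le> 1"
  shows "conjugate X f ((1 - t) *\<^sub>R a + t *\<^sub>R b) \<le> ereal ((1 - t) * A + t * B)"
proof (rule conjugate_le)
  fix x assume x: "x \<in> X"
  have a: "ereal (a \<bullet> x) - f x \<le> ereal A" and b: "ereal (b \<bullet> x) - f x \<le> ereal B"
    using conjugate_ge[OF x] fin by metis+
  show "ereal (((1 - t) *\<^sub>R a + t *\<^sub>R b) \<bullet> x) - f x \<le> ereal ((1 - t) * A + t * B)"
  proof (cases "f x")
    case (real r)
    have "(1 - t) * (a \<bullet> x - r) \<le> (1 - t) * A" "t * (b \<bullet> x - r) \<le> t * B"
      using a b t by (auto simp: real intro!: mult_left_mono)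
    then show ?thesis by (simp add: real inner_add_left algebra_simps)
  qed (use a in auto)
qed

lemma conjugate_ind_subspace:
  assumes "subspace H" "H \<subseteq> X"
  shows "conjugate X (ind_fun H) u = (if \<forall>y\<in>H. u \<bullet> y = 0 then 0 else \<infinity>)"
proof (cases "\<forall>y\<in>H. u \<bullet> y = 0")
  case True
  have "conjugate X (ind_fun H) u \<le> 0"
    by (rule conjugate_le) (use True in \<open>auto simp: ind_fun_def\<close>)
  moreover have "0 \<le> conjugate X (ind_fun H) u"
    using conjugate_ge[of 0 X u "ind_fun H"] assms by (auto simp: ind_fun_def subspace_0 subsetD zero_ereal_def)
  ultimately show ?thesis using True by simp
next
  case False
  then obtain y where y: "y \<in> H" "u \<bullet> y \<noteq> 0" by blast
  have "conjugate X (ind_fun H) u = \<infinity>"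
  proof (rule ereal_top)
    fix B :: real
    let ?v = "(B / (u \<bullet> y)) *\<^sub>R y"
    have "?v \<in> H" using y assms by (simp add: subspace_scale)
    then show "ereal B \<le> conjugate X (ind_fun H) u"
      using conjugate_ge[of ?v X u "ind_fun H"] assms y by (auto simp: ind_fun_def)
  qed
  then show ?thesis by (simp only: if_not_P[OF False])
qed

section \<open>Subgradients of convex functions on a subspace\<close>

text \<open>
  Projecting orthogonally turns a convex function on a subspace into one on the whole space, where
  separation of convex sets and continuity of convex functions are available.
\<close>

lemma orthogonal_projection_exists:
  fixes X :: "'a::euclidean_space set"
  assumes "subspace X"
  obtains \<pi> where "linear \<pi>" "\<And>x. \<pi> x \<in> X" "\<And>x. x \<in> X \<Longrightarrow> \<pi> x = x"
    "\<And>x y. y \<in> X \<Longrightarrow> \<pi> x \<bullet> y = x \<bullet> y"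
proof -
  obtain B where B: "B \<subseteq> X" "pairwise orthogonal B" "\<And>x. x \<in> B \<Longrightarrow> norm x = 1"
      "independent B" "span B = X"
    using orthonormal_basis_subspace[OF assms] by metis
  have fB: "finite B" using B(4) by (simp add: independent_imp_finite)
  define \<pi> where "\<pi> x = (\<Sum>b\<in>B. (x \<bullet> b) *\<^sub>R b)" for x
  have id: "\<pi> x = x" if "x \<in> X" for x
    unfolding \<pi>_def using orthonormal_basis_expand B fB that by blast
  show thesis
  proof
    show "linear \<pi>" unfolding \<pi>_def
      by (intro linearI) (auto simp: inner_add_left scaleR_add_left sum.distrib scaleR_sum_right)
    show "\<pi> x \<in> X" for x unfolding \<pi>_def using B(1) assms
      by (intro subspace_sum subspace_scale) auto
    show "\<pi> x = x" if "x \<in> X" for x using id that .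
    show "\<pi> x \<bullet> y = x \<bullet> y" if "y \<in> X" for x y
    proof -
      have "\<pi> x \<bullet> y = x \<bullet> \<pi> y"
        unfolding \<pi>_def by (simp add: inner_sum_left inner_sum_right inner_commute mult.commute)
      then show ?thesis using id[OF that] by simp
    qed
  qed
qed

lemma convex_on_compose_projection:
  assumes "linear \<pi>" "\<And>x. \<pi> x \<in> X" "convex_on X \<phi>"
  shows "convex_on UNIV (\<phi> \<circ> \<pi>)"
  using assms unfolding convex_on_def by (simp add: linear_add linear_cmul)

text \<open>
  A hyperplane that separates the strict epigraph from the point \<open>(x, \<phi> x)\<close> cannot be vertical, as
  \<open>\<phi> \<circ> \<pi>\<close> is finite everywhere; its slope, projected back to the subspace, is a subgradient.
\<close>

lemma convex_on_subspace_subgradient: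
  fixes \<phi> :: "'a::euclidean_space \<Rightarrow> real"
  assumes X: "subspace X" and cvx: "convex_on X \<phi>" and x: "x \<in> X"
  shows "\<exists>s\<in>X. \<forall>y\<in>X. \<phi> x + s \<bullet> (y - x) \<le> \<phi> y"
proof -
  obtain \<pi> where pi: "linear \<pi>" "\<And>x. \<pi> x \<in> X" "\<And>x. x \<in> X \<Longrightarrow> \<pi> x = x"
    "\<And>x y. y \<in> X \<Longrightarrow> \<pi> x \<bullet> y = x \<bullet> y"
    using orthogonal_projection_exists[OF X] by metis
  define \<psi> where "\<psi> = \<phi> \<circ> \<pi>"
  have cpsi: "convex_on UNIV \<psi>"
    unfolding \<psi>_def by (rule convex_on_compose_projection[OF pi(1,2) cvx])
  let ?E = "{(y, t). \<psi> y < t}"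
  have "convex ?E"
  proof (rule convexI)
    fix p q :: "'a \<times> real" and u v :: real
    assume pq: "p \<in> ?E" "q \<in> ?E" and uv: "0 \<le> u" "0 \<le> v" "u + v = 1"
    obtain a s b t where ab: "p = (a, s)" "q = (b, t)" by (metis surj_pair)
    have h: "\<psi> a < s" "\<psi> b < t" using pq ab by auto
    have "\<psi> (u *\<^sub>R a + v *\<^sub>R b) \<le> u * \<psi> a + v * \<psi> b"
      using cpsi uv unfolding convex_on_def by auto
    also have "\<dots> < u * s + v * t"
    proof (cases "u = 0")
      case False
      then have "u * \<psi> a < u * s" using h uv by simp
      moreover have "v * \<psi> b \<le> v * t" using h uv by (intro mult_left_mono) auto
      ultimately show ?thesis by simp
    qed (use h uv in auto)
    finally show "u *\<^sub>R p + v *\<^sub>R q \<in> ?E" by (simp add: ab)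
  qed
  moreover have "(0, \<psi> 0 + 1) \<in> ?E" by simp
  then have "?E \<noteq> {}" by blast
  moreover have "{(x, \<psi> x)} \<inter> ?E = {}" by auto
  ultimately obtain p \<beta> where p: "p \<noteq> 0" "\<forall>e\<in>{(x, \<psi> x)}. p \<bullet> e \<le> \<beta>" "\<forall>e\<in>?E. \<beta> \<le> p \<bullet> e"
    using separating_hyperplane_sets[of "{(x, \<psi> x)}" ?E] by auto
  obtain p1 p2 where pp: "p = (p1, p2)" by (cases p)
  have key: "p1 \<bullet> x + p2 * \<psi> x \<le> p1 \<bullet> y + p2 * t" if "\<psi> y < t" for y t
  proof -
    have "(y, t) \<in> ?E" using that by simp
    then have "\<beta> \<le> p \<bullet> (y, t)" using p(3) by blast
    moreover have "p \<bullet> (x, \<psi> x) \<le> \<beta>" using p(2) by simp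
    ultimately show ?thesis by (simp add: pp inner_Pair)
  qed
  have p2: "p2 > 0"
  proof -
    have "p2 \<ge> 0" using key[of x "\<psi> x + 1"] by (simp add: algebra_simps)
    moreover have "p2 \<noteq> 0"
    proof
      assume 0: "p2 = 0"
      have "p1 \<bullet> p1 \<le> 0" using key[of "x - p1" "\<psi> (x - p1) + 1"] 0 by (simp add: inner_diff_right)
      moreover have "p1 \<noteq> 0" using p(1) pp 0 by (auto simp: zero_prod_def)
      ultimately show False by (metis inner_gt_zero_iff not_less)
    qed
    ultimately show ?thesis by simp
  qed
  define s where "s = - (1 / p2) *\<^sub>R p1"
  have sub: "\<psi> x + s \<bullet> (y - x) \<le> \<psi> y" for y
  proof (rule field_le_epsilon)
    fix e :: real assume "e > 0"
    then have "p2 * \<psi> x - p1 \<bullet> (y - x) \<le> p2 * (\<psi> y + e)"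
      using key[of y "\<psi> y + e"] by (simp add: inner_diff_right)
    then have "\<psi> x - (p1 \<bullet> (y - x)) / p2 \<le> \<psi> y + e" using p2 by (simp add: field_simps)
    then show "\<psi> x + s \<bullet> (y - x) \<le> \<psi> y + e" by (simp add: s_def)
  qed
  have "\<phi> x + \<pi> s \<bullet> (y - x) \<le> \<phi> y" if "y \<in> X" for y
    using sub[of y] pi(3)[OF that] pi(3)[OF x] pi(4)[of "y - x" s] subspace_diff[OF X that x]
    by (simp add: \<psi>_def)
  then show ?thesis using pi(2) by blast
qed

text \<open>
  Moving from \<open>q\<close> by a unit step in the direction of \<open>s\<close> raises \<open>\<phi>\<close> by at least \<open>norm s\<close>,
  and \<open>\<phi>\<close> is bounded on bounded sets by continuity.
\<close>

lemma subgradients_bounded: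
  fixes \<phi> :: "'a::euclidean_space \<Rightarrow> real"
  assumes X: "subspace X" and cvx: "convex_on X \<phi>"
  shows "\<exists>L. \<forall>q\<in>X. \<forall>s\<in>X. norm q \<le> R \<longrightarrow> (\<forall>y\<in>X. \<phi> q + s \<bullet> (y - q) \<le> \<phi> y) \<longrightarrow> norm s \<le> L"
proof -
  obtain \<pi> where pi: "linear \<pi>" "\<And>x. \<pi> x \<in> X" "\<And>x. x \<in> X \<Longrightarrow> \<pi> x = x"
    "\<And>x y. y \<in> X \<Longrightarrow> \<pi> x \<bullet> y = x \<bullet> y"
    using orthogonal_projection_exists[OF X] by metis
  have "convex_on UNIV (\<phi> \<circ> \<pi>)"
    by (rule convex_on_compose_projection[OF pi(1,2) cvx])
  then have "continuous_on UNIV (\<phi> \<circ> \<pi>)" using convex_on_continuous open_UNIV by blast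
  then have "compact ((\<phi> \<circ> \<pi>) ` cball 0 (R + 1))"
    by (intro compact_continuous_image) (auto intro: continuous_on_subset)
  then obtain B where B: "\<And>y. y \<in> cball 0 (R + 1) \<Longrightarrow> \<bar>(\<phi> \<circ> \<pi>) y\<bar> \<le> B"
    using compact_imp_bounded bounded_iff by (metis (no_types, lifting) imageI real_norm_def)
  have "norm s \<le> 2 * B"
    if q: "q \<in> X" "norm q \<le> R" and s: "s \<in> X" "\<forall>y\<in>X. \<phi> q + s \<bullet> (y - q) \<le> \<phi> y" for q s
  proof -
    let ?y = "q + sgn s"
    have y: "?y \<in> X" using X q s by (simp add: sgn_div_norm subspace_add subspace_scale)
    have "s \<bullet> sgn s = norm s"
      by (cases "s = 0") (simp_all add: sgn_div_norm power2_norm_eq_inner[symmetric] power2_eq_square)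
    then have "\<phi> q + norm s \<le> \<phi> ?y" using s(2) y by (metis add_diff_cancel_left')
    moreover have "norm ?y \<le> R + 1" using norm_triangle_ineq[of q "sgn s"] q by (simp add: norm_sgn split: if_splits)
    ultimately show ?thesis
      using B[of ?y] B[of q] q y pi(3) by (simp add: abs_le_iff)
  qed
  then show ?thesis by blast
qed

text \<open>
  Separating a point just below the graph from the closed epigraph yields the minorant.  It makes the
  conjugate of a node function finite somewhere, so that the subproblems of the algorithm have a finite
  minimal value.
\<close>

lemma closed_convex_fun_affine_minorant:
  fixes f :: "'a::euclidean_space \<Rightarrow> ereal"
  assumes X: "subspace X" and f: "closed_convex_fun X f" and x0: "x0 \<in> X" "f x0 \<noteq> \<infinity>"
  shows "\<exists>s\<in>X. \<exists>b::real. \<forall>y\<in>X. ereal (s \<bullet> y - b) \<le> f y"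
proof -
  obtain \<pi> where pi: "linear \<pi>" "\<And>x. \<pi> x \<in> X" "\<And>x y. y \<in> X \<Longrightarrow> \<pi> x \<bullet> y = x \<bullet> y"
    using orthogonal_projection_exists[OF X] by metis
  obtain t0 where t0: "f x0 = ereal t0"
    using f x0 unfolding closed_convex_fun_def by (metis ereal_cases)
  let ?E = "{(x, t :: real). x \<in> X \<and> f x \<le> ereal t}"
  have "(x0, t0 - 1) \<notin> ?E" using t0 by simp
  then obtain p \<beta> where p: "p \<bullet> (x0, t0 - 1) < \<beta>" "\<forall>e\<in>?E. \<beta> < p \<bullet> e"
    using separating_hyperplane_closed_point[of ?E "(x0, t0 - 1)"] f
    unfolding closed_convex_fun_def by auto
  obtain p1 p2 where pp: "p = (p1, p2)" by (cases p)
  have key: "\<beta> < p1 \<bullet> y + p2 * t" if "y \<in> X" "f y \<le> ereal t" for y t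
  proof -
    have "(y, t) \<in> ?E" using that by simp
    then show ?thesis using p(2) by (auto simp: pp inner_Pair)
  qed
  have p2: "p2 > 0" using key[of x0 t0] p(1) x0 t0 by (simp add: pp inner_Pair algebra_simps)
  define s where "s = \<pi> (- (1 / p2) *\<^sub>R p1)"
  have s: "s \<bullet> y = - (p1 \<bullet> y) / p2" if "y \<in> X" for y
    unfolding s_def using pi(3)[OF that] by simp
  have "ereal (s \<bullet> y - (- \<beta> / p2)) \<le> f y" if y: "y \<in> X" for y
  proof (cases "f y")
    case (real t)
    show ?thesis using key[OF y, of t] p2 s[OF y] real by (simp add: field_simps)
  next
    case MInf
    then show ?thesis using f y unfolding closed_convex_fun_def by auto
  qed simp
  then show ?thesis using pi(2) unfolding s_def by blast
qed

lemma closed_convex_fun_finite_imp_convex_on: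
  assumes "closed_convex_fun X f" "\<And>x. x \<in> X \<Longrightarrow> f x < \<infinity>" "convex X"
  shows "convex_on X (\<lambda>x. real_of_ereal (f x))"
proof -
  have fin: "f x \<le> ereal t \<longleftrightarrow> real_of_ereal (f x) \<le> t" if "x \<in> X" for x t
    using assms(1,2) that unfolding closed_convex_fun_def by (cases "f x") auto
  have "epigraph X (\<lambda>x. real_of_ereal (f x)) = {(x, t). x \<in> X \<and> f x \<le> ereal t}"
    using fin by (auto simp: epigraph_def)
  then have "convex (epigraph X (\<lambda>x. real_of_ereal (f x)))"
    using assms unfolding closed_convex_fun_def by simp
  then show ?thesis by (simp add: convex_epigraph)
qed

lemma convex_on_transfer:
  assumes "convex_on X f" "\<And>x. x \<in> X \<Longrightarrow> h x = f x"
  shows "convex_on X h"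
proof -
  have X: "convex X" using assms(1) unfolding convex_on_def by blast
  have eq: "h (u *\<^sub>R x + v *\<^sub>R y) = f (u *\<^sub>R x + v *\<^sub>R y)"
    if "x \<in> X" "y \<in> X" "0 \<le> u" "0 \<le> v" "u + v = 1" for x y u v
    using assms(2) convexD[OF X] that by blast
  show ?thesis using assms eq unfolding convex_on_def by simp
qed

section \<open>Minimizers of quadratically regularized convex functions\<close>

lemma le_of_le_add_small_multiple:
  fixes a b K :: real
  assumes "\<And>t. 0 < t \<Longrightarrow> t \<le> 1 \<Longrightarrow> a \<le> b + t * K"
  shows "a \<le> b"
proof (rule tendsto_lowerbound)
  show "((\<lambda>t. b + t * K) \<longlongrightarrow> b) (at_right 0)"
    by (auto intro!: tendsto_eq_intros)
  show "\<forall>\<^sub>F t in at_right 0. a \<le> b + t * K"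
    unfolding eventually_at_right_field using assms by (intro exI[of _ 1]) auto
qed simp

lemma prox_minimizer_subgradient:
  fixes m :: "'b::real_inner \<Rightarrow> real"
  assumes cvx: "convex_on X m"
    and argmin: "is_arg_min (\<lambda>x. (norm (c - x))\<^sup>2 / 2 + m x) (\<lambda>x. x \<in> X) p"
    and y: "y \<in> X"
  shows "m p + (c - p) \<bullet> (y - p) \<le> m y"
proof -
  have p: "p \<in> X" using argmin unfolding is_arg_min_def by blast
  have "(c - p) \<bullet> (y - p) \<le> m y - m p + t * ((norm (y - p))\<^sup>2 / 2)" if t: "0 < t" "t \<le> 1" for t
  proof -
    let ?u = "(1 - t) *\<^sub>R p + t *\<^sub>R y"
    have u: "?u \<in> X" using cvx p y t unfolding convex_on_def convex_alt by auto
    have "(norm (c - p))\<^sup>2 / 2 + m p \<le> (norm (c - ?u))\<^sup>2 / 2 + m ?u"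
      using argmin u unfolding is_arg_min_def by (meson not_le_imp_less)
    moreover have "m ?u \<le> (1 - t) * m p + t * m y"
      using cvx p y t unfolding convex_on_def by auto
    moreover have "(norm (c - ?u))\<^sup>2 = (norm (c - p))\<^sup>2 - 2 * t * ((c - p) \<bullet> (y - p)) + t\<^sup>2 * (norm (y - p))\<^sup>2"
    proof -
      have "c - ?u = (c - p) - t *\<^sub>R (y - p)" by (simp add: algebra_simps)
      then show ?thesis
        unfolding power2_norm_eq_inner
        by (simp add: inner_diff_left inner_diff_right inner_commute power2_eq_square algebra_simps)
    qed
    ultimately have "t * ((c - p) \<bullet> (y - p)) \<le> t * (m y - m p + t * ((norm (y - p))\<^sup>2 / 2))"
      by (simp add: power2_eq_square algebra_simps)
    then show ?thesis using t by simp
  qed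
  then have "(c - p) \<bullet> (y - p) \<le> m y - m p" by (rule le_of_le_add_small_multiple)
  then show ?thesis by simp
qed

text \<open>
  At a joint minimizer the residual \<open>b - (\<Sum>\<alpha>\<in>A. z \<alpha>)\<close> is a subgradient of each conjugate: moving
  one block by \<open>t\<close> towards \<open>y\<close> changes the conjugates by at most \<open>t\<close> times their difference, the
  quadratic by \<open>- t\<close> times the inner product with the residual up to \<open>O(t\<^sup>2)\<close>.
\<close>

lemma block_minimizer_subgradients:
  fixes f :: "'k \<Rightarrow> 'b::real_inner \<Rightarrow> ereal"
  assumes A: "finite A" and X: "convex X"
    and argmin: "is_arg_min (\<lambda>u. ereal ((norm (b - (\<Sum>\<alpha>\<in>A. u \<alpha>)))\<^sup>2 / 2)
        + (\<Sum>\<alpha>\<in>A. conjugate X (f \<alpha>) (u \<alpha>))) (\<lambda>u. \<forall>\<alpha>\<in>A. u \<alpha> \<in> X) z"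
    and dom: "\<And>\<alpha>. \<alpha> \<in> A \<Longrightarrow> \<exists>x\<in>X. f \<alpha> x \<noteq> \<infinity>"
    and proper: "\<And>\<alpha>. \<alpha> \<in> A \<Longrightarrow> \<exists>u\<in>X. conjugate X (f \<alpha>) u \<noteq> \<infinity>"
    and \<alpha>: "\<alpha> \<in> A"
  shows "\<bar>conjugate X (f \<alpha>) (z \<alpha>)\<bar> \<noteq> \<infinity>"
    and "y \<in> X \<Longrightarrow> conjugate X (f \<alpha>) (z \<alpha>) + ereal ((b - (\<Sum>\<alpha>\<in>A. z \<alpha>)) \<bullet> (y - z \<alpha>))
           \<le> conjugate X (f \<alpha>) y"
proof -
  let ?C = "\<lambda>\<alpha>. conjugate X (f \<alpha>)"
  let ?J = "\<lambda>u. ereal ((norm (b - (\<Sum>\<alpha>\<in>A. u \<alpha>)))\<^sup>2 / 2) + (\<Sum>\<alpha>\<in>A. ?C \<alpha> (u \<alpha>))"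
  have zX: "z \<alpha> \<in> X" if "\<alpha> \<in> A" for \<alpha> using argmin that unfolding is_arg_min_def by blast
  have min: "?J z \<le> ?J u" if "\<And>\<alpha>. \<alpha> \<in> A \<Longrightarrow> u \<alpha> \<in> X" for u
    using argmin that unfolding is_arg_min_def by (meson not_le_imp_less)
  have nm: "?C \<alpha> u \<noteq> -\<infinity>" if "\<alpha> \<in> A" for \<alpha> u
    using dom[OF that] conjugate_not_MInf by metis
  obtain u0 where u0: "\<And>\<alpha>. \<alpha> \<in> A \<Longrightarrow> u0 \<alpha> \<in> X \<and> ?C \<alpha> (u0 \<alpha>) \<noteq> \<infinity>"
    using proper by metis
  have "?J u0 \<noteq> \<infinity>" using u0 A by (auto simp: sum_Pinfty)
  then have "?J z \<noteq> \<infinity>" using min[of u0] u0 by auto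
  then have fin: "\<bar>?C \<alpha> (z \<alpha>)\<bar> \<noteq> \<infinity>" if "\<alpha> \<in> A" for \<alpha>
    using that nm A by (auto simp: sum_Pinfty)
  show "\<bar>?C \<alpha> (z \<alpha>)\<bar> \<noteq> \<infinity>" using fin \<alpha> .
  assume y: "y \<in> X"
  show "?C \<alpha> (z \<alpha>) + ereal ((b - (\<Sum>\<alpha>\<in>A. z \<alpha>)) \<bullet> (y - z \<alpha>)) \<le> ?C \<alpha> y"
  proof (cases "?C \<alpha> y")
    case (real B)
    define c where "c \<alpha> = real_of_ereal (?C \<alpha> (z \<alpha>))" for \<alpha>
    have c: "?C \<alpha> (z \<alpha>) = ereal (c \<alpha>)" if "\<alpha> \<in> A" for \<alpha>
      using fin[OF that] unfolding c_def by (simp add: ereal_real)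
    define r where "r = b - (\<Sum>\<alpha>\<in>A. z \<alpha>)"
    define d where "d = y - z \<alpha>"
    have ineq: "r \<bullet> d \<le> B - c \<alpha> + t * ((norm d)\<^sup>2 / 2)" if t: "0 < t" "t \<le> 1" for t
    proof -
      define u where "u = z(\<alpha> := (1 - t) *\<^sub>R z \<alpha> + t *\<^sub>R y)"
      have uX: "u \<beta> \<in> X" if "\<beta> \<in> A" for \<beta>
        using that zX y X t \<alpha> unfolding u_def convex_alt by auto
      have su: "(\<Sum>\<alpha>\<in>A. u \<alpha>) = (\<Sum>\<alpha>\<in>A. z \<alpha>) + t *\<^sub>R d"
        using A \<alpha> by (simp add: u_def d_def sum.remove algebra_simps)
      have Cu: "?C \<alpha> (u \<alpha>) \<le> ereal ((1 - t) * c \<alpha> + t * B)"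
        using conjugate_convex[OF c[OF \<alpha>] real, of t] t by (simp add: u_def)
      have rest: "(\<Sum>\<beta>\<in>A - {\<alpha>}. ?C \<beta> (z \<beta>)) = ereal (\<Sum>\<beta>\<in>A - {\<alpha>}. c \<beta>)"
        using c by simp
      have restu: "(\<Sum>\<beta>\<in>A - {\<alpha>}. ?C \<beta> (u \<beta>)) = ereal (\<Sum>\<beta>\<in>A - {\<alpha>}. c \<beta>)"
        using c by (simp add: u_def)
      have "ereal ((norm r)\<^sup>2 / 2 + c \<alpha> + (\<Sum>\<beta>\<in>A - {\<alpha>}. c \<beta>)) = ?J z"
        using A \<alpha> c[OF \<alpha>] rest by (simp add: sum.remove[of A \<alpha>] r_def)
      also have "?J z \<le> ?J u" by (rule min) (rule uX)
      also have "?J u \<le> ereal ((norm (r - t *\<^sub>R d))\<^sup>2 / 2 + ((1 - t) * c \<alpha> + t * B) + (\<Sum>\<beta>\<in>A - {\<alpha>}. c \<beta>))"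
      proof -
        have "(\<Sum>\<beta>\<in>A. ?C \<beta> (u \<beta>)) \<le> ereal ((1 - t) * c \<alpha> + t * B) + ereal (\<Sum>\<beta>\<in>A - {\<alpha>}. c \<beta>)"
          unfolding sum.remove[OF A \<alpha>, of "\<lambda>\<beta>. ?C \<beta> (u \<beta>)"] restu using Cu by (rule add_right_mono)
        then have "?J u \<le> ereal ((norm (b - (\<Sum>\<alpha>\<in>A. u \<alpha>)))\<^sup>2 / 2) + (ereal ((1 - t) * c \<alpha> + t * B) + ereal (\<Sum>\<beta>\<in>A - {\<alpha>}. c \<beta>))"
          by (rule add_left_mono)
        then show ?thesis by (simp add: su r_def diff_diff_eq add.assoc)
      qed
      finally have "ereal ((norm r)\<^sup>2 / 2 + c \<alpha> + (\<Sum>\<beta>\<in>A - {\<alpha>}. c \<beta>))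
          \<le> ereal ((norm (r - t *\<^sub>R d))\<^sup>2 / 2 + ((1 - t) * c \<alpha> + t * B) + (\<Sum>\<beta>\<in>A - {\<alpha>}. c \<beta>))" .
      then have "(norm r)\<^sup>2 / 2 + c \<alpha> \<le> (norm (r - t *\<^sub>R d))\<^sup>2 / 2 + ((1 - t) * c \<alpha> + t * B)"
        by simp
      moreover have "(norm (r - t *\<^sub>R d))\<^sup>2 = (norm r)\<^sup>2 - 2 * t * (r \<bullet> d) + t\<^sup>2 * (norm d)\<^sup>2"
        unfolding power2_norm_eq_inner
        by (simp add: inner_diff_left inner_diff_right inner_commute power2_eq_square algebra_simps)
      ultimately have "t * (r \<bullet> d) \<le> t * (B - c \<alpha> + t * ((norm d)\<^sup>2 / 2))"
        by (simp add: power2_eq_square algebra_simps)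
      then show ?thesis using t by simp
    qed
    have "r \<bullet> d \<le> B - c \<alpha>"
      by (rule le_of_le_add_small_multiple) (rule ineq)
    then show ?thesis using c[OF \<alpha>] real by (simp add: r_def d_def)
  qed (use nm[OF \<alpha>] in auto)
qed

section \<open>From a recursive inequality to a rate\<close>

text \<open>
  The bound \<open>a n \<le> K / n\<close> propagates from \<open>m\<close> to \<open>m + 2\<close>: if it failed at \<open>m + 2\<close>, the decrease
  would exceed \<open>\<gamma> K\<^sup>2 / (m + 2)\<^sup>2\<close>, which for \<open>K \<ge> 4 / \<gamma>\<close> and \<open>m \<ge> 2\<close> is at least
  \<open>K / m - K / (m + 2)\<close>.
\<close>

lemma two_step_quadratic_decrease_rate:
  fixes a :: "nat \<Rightarrow> real"
  assumes nonneg: "\<And>n. n \<ge> 2 \<Longrightarrow> a n \<ge> 0" and \<gamma>: "\<gamma> > 0"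
    and dec: "\<And>n. n \<ge> 2 \<Longrightarrow> a (n + 2) \<le> a n - \<gamma> * (a (n + 2))\<^sup>2"
  shows "a \<in> O(\<lambda>n. 1 / real n)"
proof -
  \<comment> \<open>The last two entries start the induction at the indices 2 and 3.\<close>
  define K where "K = Max {4 / \<gamma>, 2 * a 2, 3 * a 3}"
  have K: "4 / \<gamma> \<le> K" "2 * a 2 \<le> K" "3 * a 3 \<le> K" unfolding K_def by (auto intro: Max_ge)
  have bound: "n \<ge> 2 \<Longrightarrow> a n \<le> K / n" for n :: nat
  proof (induction n rule: less_induct)
    case (less n)
    consider "n = 2" | "n = 3" | "n \<ge> 4" using less.prems by linarith
    then show ?case
    proof cases
      case 3
      define m where "m = n - 2"
      have m: "m \<ge> 2" "n = m + 2" "m < n" using 3 by (auto simp: m_def)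
      have IH: "a m \<le> K / m" using less.IH m by simp
      show ?thesis
      proof (rule ccontr)
        assume "\<not> ?thesis"
        then have big: "a n > K / n" by simp
        have Kp: "K > 0" using K(1) \<gamma> by (meson divide_pos_pos less_le_trans zero_less_numeral)
        have "(K / n)\<^sup>2 \<le> (a n)\<^sup>2" using big Kp by (intro power_mono) auto
        then have "K / n + \<gamma> * (K / n)\<^sup>2 < K / m"
          using dec[of m] m(1) IH big \<gamma> mult_left_mono[of "(K / n)\<^sup>2" "(a n)\<^sup>2" \<gamma>]
          unfolding m(2)[symmetric] by linarith
        then have "\<gamma> * (K / n)\<^sup>2 < K / m - K / n" by simp
        also have "\<dots> = 2 * K / (real m * real n)" using m by (simp add: field_simps)
        finally have "\<gamma> * K * K / (real n * real n) < 2 * K / (real m * real n)"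
          by (simp add: power2_eq_square)
        then have "\<gamma> * K * K / (real n * real n) * (real m * real n * real n)
            < 2 * K / (real m * real n) * (real m * real n * real n)"
          using m by (intro mult_strict_right_mono) auto
        then have "K * (\<gamma> * K * m) < K * (2 * n)"
          using m(1) \<open>n \<ge> 4\<close> by (simp add: mult.commute mult.left_commute)
        then have "\<gamma> * K * m < 2 * n" using Kp by simp
        moreover have "4 * real m \<le> \<gamma> * K * m"
          using K(1) \<gamma> by (intro mult_right_mono) (auto simp: field_simps)
        ultimately show False using m by simp
      qed
    qed (use K in auto)
  qed
  show ?thesis
  proof (rule bigoI)
    show "\<forall>\<^sub>F n in sequentially. norm (a n) \<le> K * norm (1 / real n)"
      using eventually_ge_at_top[of 2] by eventually_elim (use bound nonneg in auto)
  qed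
qed

section \<open>The product space\<close>

lemma problem_dataD:
  assumes "problem_data P"
  shows "nodes P \<inter> edges P = {}"
    "nodes P = nodes1 P \<union> nodes2 P \<union> nodes3 P \<union> nodes4 P"
    "\<forall>i\<in>nodes P. subspace (node_space P i)"
    "\<forall>i\<in>nodes P. closed_convex_fun (node_space P i) (nodefun P i)"
    "\<forall>i\<in>nodes4 P. \<forall>x\<in>node_space P i. nodefun P i x < \<infinity>"
    "\<forall>\<alpha>\<in>edges P. subspace (hyper P \<alpha>) \<and> hyper P \<alpha> \<subseteq> Xprod P"
    "xbar P \<in> Xprod P"
  using assms unfolding problem_data_def by - (elim conjE, assumption)+

lemma axis_in_Xprod:
  assumes "problem_data P" "i \<in> nodes P" "s \<in> node_space P i"
  shows "axis i s \<in> Xprod P"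
  using problem_dataD(3)[OF assms(1)] assms(2,3) unfolding Xprod_def
  by (auto simp: axis_def subspace_0)

lemma subspace_Xprod:
  assumes "problem_data P"
  shows "subspace (Xprod P)"
  using problem_dataD(3)[OF assms] unfolding Xprod_def
  by (simp add: subspace_def)

lemma conjugate_axis_le:
  assumes "i \<in> nodes P" "\<And>y. y \<in> node_space P i \<Longrightarrow> ereal (s \<bullet> y - b) \<le> \<phi> y"
  shows "conjugate (Xprod P) (\<lambda>x. \<phi> (x $ i)) (axis i s) \<le> ereal b"
proof (rule conjugate_le)
  fix x assume "x \<in> Xprod P"
  then have "ereal (s \<bullet> (x $ i) - b) \<le> \<phi> (x $ i)"
    using assms unfolding Xprod_def by blast
  then show "ereal (axis i s \<bullet> x) - \<phi> (x $ i) \<le> ereal b"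
    by (cases "\<phi> (x $ i)") (auto simp: inner_axis' )
qed

text \<open>
  A function of the single coordinate \<open>i\<close> does not change along the other coordinates, so its
  conjugate is infinite at every vector with a nonzero component outside \<open>i\<close>.
\<close>

lemma conjugate_coordinate_support:
  assumes P: "problem_data P" and u: "u \<in> Xprod P"
    and x0: "x0 \<in> Xprod P" "\<phi> (x0 $ i) \<noteq> \<infinity>"
    and fin: "conjugate (Xprod P) (\<lambda>x. \<phi> (x $ i)) u \<noteq> \<infinity>" and j: "j \<noteq> i"
  shows "u $ j = 0"
proof (rule ccontr)
  assume nz: "u $ j \<noteq> 0"
  then have jn: "j \<in> nodes P" using u unfolding Xprod_def by auto
  then have uj: "u $ j \<in> node_space P j" using u unfolding Xprod_def by blast
  have "conjugate (Xprod P) (\<lambda>x. \<phi> (x $ i)) u = \<infinity>"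
  proof (rule ereal_top)
    fix B :: real
    show "ereal B \<le> conjugate (Xprod P) (\<lambda>x. \<phi> (x $ i)) u"
    proof (cases "\<phi> (x0 $ i)")
      case (real r)
      let ?t = "(B + r - u \<bullet> x0) / (u $ j \<bullet> u $ j)"
      let ?x = "x0 + ?t *\<^sub>R axis j (u $ j)"
      have xX: "?x \<in> Xprod P"
        using axis_in_Xprod[OF P jn uj] subspace_Xprod[OF P] x0
        by (intro subspace_add subspace_scale)
      have xi: "?x $ i = x0 $ i" using j by (simp add: axis_def)
      have ux: "u \<bullet> ?x = B + r" using nz by (simp add: inner_add_right inner_axis)
      have "ereal B = ereal (u \<bullet> ?x) - \<phi> (?x $ i)" unfolding xi ux real by simp
      then show ?thesis
        using conjugate_ge[OF xX, of u "\<lambda>x. \<phi> (x $ i)"] by simp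
    qed (use conjugate_ge[OF x0(1), of u "\<lambda>x. \<phi> (x $ i)"] x0 in auto)
  qed
  then show False using fin by simp
qed

lemma inner_supported:
  fixes u x :: "'a::euclidean_space ^ 'k::finite"
  assumes "\<And>j. j \<noteq> i \<Longrightarrow> u $ j = 0"
  shows "u \<bullet> x = u $ i \<bullet> x $ i"
proof -
  have "u \<bullet> x = (\<Sum>j\<in>{i}. u $ j \<bullet> x $ j)"
    unfolding inner_vec_def by (rule sum.mono_neutral_right) (use assms in auto)
  then show ?thesis by simp
qed

section \<open>Invariants of the iterates\<close>

locale dykstra =
  fixes P :: "('k::finite, 'a::euclidean_space) problem"
    and wbar :: nat
    and Creg :: real
    and z :: "nat \<Rightarrow> nat \<Rightarrow> 'k \<Rightarrow> 'a ^ 'k"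
    and g :: "nat \<Rightarrow> nat \<Rightarrow> 'k \<Rightarrow> 'a \<Rightarrow> real"
    and S :: "nat \<Rightarrow> nat \<Rightarrow> 'k set"
    and En :: "nat \<Rightarrow> 'k set"
    and zstar :: "'k \<Rightarrow> 'a ^ 'k"
  assumes data: "problem_data P"
    and wbar: "wbar > 0"
    and Creg: "regularity_const P Creg"
    and run: "dykstra_run P wbar Creg z g S En"
    and feasible: "feasible P"
    and En_eq: "\<And>n. n \<ge> 1 \<Longrightarrow> En n = (\<Union>w\<in>{1..wbar}. S n w) \<inter> edges P"
    and cover: "\<And>n. n \<ge> 1 \<Longrightarrow> nodes P \<subseteq> (\<Union>w\<in>{1..wbar}. S n w)"
    and A2: "assumption_A2 P wbar S"
    and A3: "assumption_A3 P S"
    and optimizer: "dual_optimizer P zstar"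
    and iterates_bounded:
      "bounded {z n w \<alpha> | n w \<alpha>. n \<ge> 1 \<and> w \<in> {1..wbar} \<and> \<alpha> \<in> nodes P \<union> edges P}"
begin

abbreviation blocks :: "'k set" where "blocks \<equiv> edges P \<union> nodes P"

definition conj_at :: "nat \<Rightarrow> nat \<Rightarrow> 'k \<Rightarrow> 'a ^ 'k \<Rightarrow> ereal" where
  "conj_at n w \<alpha> u = conjugate (Xprod P) (bfn P g n w \<alpha>) u"

definition x :: "nat \<Rightarrow> nat \<Rightarrow> 'a ^ 'k" where
  "x n w = xbar P - (\<Sum>\<alpha>\<in>blocks. z n w \<alpha>)"

text \<open>
  The invariant of the run.  The subspaces named here are those outside of which the conjugates are
  infinite, and convexity of the minorants provides the subgradients that \<open>contact_at_end\<close> tests with.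
\<close>

definition valid :: "nat \<Rightarrow> nat \<Rightarrow> bool" where
  "valid n w \<longleftrightarrow>
     (\<forall>i\<in>nodes P. z n w i \<in> Xprod P \<and> (\<forall>j. j \<noteq> i \<longrightarrow> z n w i $ j = 0)) \<and>
     (\<forall>\<alpha>\<in>edges P. z n w \<alpha> \<in> perp P (hyper P \<alpha>)) \<and>
     (\<forall>i\<in>nodes4 P. convex_on (node_space P i) (g n w i) \<and>
        (\<forall>y\<in>node_space P i. ereal (g n w i y) \<le> nodefun P i y))"

lemmas nodes_edges_disjoint = problem_dataD(1)[OF data]

lemma nodes4_subset: "nodes4 P \<subseteq> nodes P"
  using problem_dataD(2)[OF data] by simp

lemma node_subspace: "i \<in> nodes P \<Longrightarrow> subspace (node_space P i)"
  using problem_dataD(3)[OF data] by simp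

lemma nodefun_closed: "i \<in> nodes P \<Longrightarrow> closed_convex_fun (node_space P i) (nodefun P i)"
  using problem_dataD(4)[OF data] by simp

lemma nodefun4_finite:
  assumes "i \<in> nodes4 P" "y \<in> node_space P i"
  shows "nodefun P i y = ereal (real_of_ereal (nodefun P i y))"
proof -
  have "nodefun P i y \<noteq> -\<infinity>" "nodefun P i y \<noteq> \<infinity>"
    using assms problem_dataD(5)[OF data] nodefun_closed[of i] nodes4_subset
    unfolding closed_convex_fun_def by auto
  then show ?thesis by (cases "nodefun P i y") auto
qed

lemma edges_hyper: "\<alpha> \<in> edges P \<Longrightarrow> subspace (hyper P \<alpha>) \<and> hyper P \<alpha> \<subseteq> Xprod P"
  using problem_dataD(6)[OF data] by simp

lemmas Xprod_subspace = subspace_Xprod[OF data]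

lemmas xbar_in = problem_dataD(7)[OF data]

lemma Xprod_coord: "v \<in> Xprod P \<Longrightarrow> i \<in> nodes P \<Longrightarrow> v $ i \<in> node_space P i"
  unfolding Xprod_def by blast

lemma perp_iff: "u \<in> perp P A \<longleftrightarrow> u \<in> Xprod P \<and> (\<forall>y\<in>A. u \<bullet> y = 0)"
  unfolding perp_def orthogonal_comp_def orthogonal_def by (auto simp: inner_commute)

lemma feasible_point: "\<exists>v\<in>Xprod P. \<forall>\<alpha>\<in>blocks. bf P \<alpha> v \<noteq> \<infinity>"
proof -
  obtain v where v: "v \<in> Xprod P" "primal P v < \<infinity>"
    using feasible unfolding feasible_def by blast
  have "(\<Sum>\<alpha>\<in>nodes P \<union> edges P. bf P \<alpha> v) \<noteq> \<infinity>"
    using v(2) unfolding primal_def by auto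
  then show ?thesis using v(1) by (auto simp: sum_Pinfty)
qed

lemma bfn_nodes4: "i \<in> nodes4 P \<Longrightarrow> bfn P g n w i = (\<lambda>v. ereal (g n w i (v $ i)))"
  unfolding bfn_def by simp

lemma bfn_other: "\<alpha> \<notin> nodes4 P \<Longrightarrow> bfn P g n w \<alpha> = bf P \<alpha>"
  unfolding bfn_def by simp

lemma bf_node: "i \<in> nodes P \<Longrightarrow> bf P i = (\<lambda>v. nodefun P i (v $ i))"
  unfolding bf_def by simp

lemma bfn_dom: "\<exists>v\<in>Xprod P. \<forall>\<alpha>\<in>blocks. bfn P g n w \<alpha> v \<noteq> \<infinity>"
  using feasible_point unfolding bfn_def by auto

lemma conj_at_not_MInf: "\<alpha> \<in> blocks \<Longrightarrow> conj_at n w \<alpha> u \<noteq> -\<infinity>"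
  using bfn_dom conjugate_not_MInf unfolding conj_at_def by blast

lemma conj_at_edge:
  assumes "\<alpha> \<in> edges P"
  shows "conj_at n w \<alpha> u = (if \<forall>y\<in>hyper P \<alpha>. u \<bullet> y = 0 then 0 else \<infinity>)"
proof -
  have "bfn P g n w \<alpha> = ind_fun (hyper P \<alpha>)"
    using assms nodes_edges_disjoint nodes4_subset by (auto simp: bfn_def bf_def fun_eq_iff)
  then show ?thesis
    unfolding conj_at_def using conjugate_ind_subspace edges_hyper[OF assms] by metis
qed

lemma conj_at_edge_perp: "\<alpha> \<in> edges P \<Longrightarrow> u \<in> perp P (hyper P \<alpha>) \<Longrightarrow> conj_at n w \<alpha> u = 0"
  by (simp add: conj_at_edge perp_iff)

text \<open>
  Finiteness of the conjugates alone confines the minimizers of a block update: for an edge to the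
  orthogonal complement of its subspace, and for a node to its own coordinate.
\<close>

lemma perp_of_conj_at: "\<alpha> \<in> edges P \<Longrightarrow> u \<in> Xprod P \<Longrightarrow> conj_at n w \<alpha> u \<noteq> \<infinity> \<Longrightarrow> u \<in> perp P (hyper P \<alpha>)"
  by (auto simp: conj_at_edge perp_iff split: if_splits)

lemma conj_at_node_support:
  assumes i: "i \<in> nodes P" and u: "u \<in> Xprod P" "conj_at n w i u \<noteq> \<infinity>" and j: "j \<noteq> i"
  shows "u $ j = 0"
proof -
  obtain \<phi> where phi: "bfn P g n w i = (\<lambda>v. \<phi> (v $ i))"
    using bfn_nodes4 bfn_other bf_node[OF i] by metis
  obtain v where "v \<in> Xprod P" "\<phi> (v $ i) \<noteq> \<infinity>" using bfn_dom[of n w] i phi by (metis UnI2)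
  then show ?thesis
    using conjugate_coordinate_support[OF data u(1), of v \<phi> i j] u(2) j phi by (simp add: conj_at_def)
qed

lemma conj_at_proper:
  assumes v: "valid n w" and \<alpha>: "\<alpha> \<in> blocks"
  shows "\<exists>u\<in>Xprod P. conj_at n w \<alpha> u \<noteq> \<infinity>"
proof -
  consider "\<alpha> \<in> edges P" | "\<alpha> \<in> nodes4 P" | "\<alpha> \<in> nodes P" "\<alpha> \<notin> nodes4 P" using \<alpha> by blast
  then show ?thesis
  proof cases
    case 1
    then show ?thesis
      using conj_at_edge[OF 1, of n w 0] subspace_0[OF Xprod_subspace] by (auto intro!: bexI[of _ 0])
  next
    case 2
    then have i: "\<alpha> \<in> nodes P" using nodes4_subset by blast
    have "convex_on (node_space P \<alpha>) (g n w \<alpha>)" using v 2 unfolding valid_def by simp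
    from convex_on_subspace_subgradient[OF node_subspace[OF i] this subspace_0[OF node_subspace[OF i]]]
    obtain s where s: "s \<in> node_space P \<alpha>" "\<forall>y\<in>node_space P \<alpha>. g n w \<alpha> 0 + s \<bullet> (y - 0) \<le> g n w \<alpha> y"
      by blast
    have "conj_at n w \<alpha> (axis \<alpha> s) \<le> ereal (- g n w \<alpha> 0)"
      unfolding conj_at_def bfn_nodes4[OF 2]
      by (rule conjugate_axis_le[OF i, of _ _ "\<lambda>t. ereal (g n w \<alpha> t)"]) (use s(2) in auto)
    then have "conj_at n w \<alpha> (axis \<alpha> s) \<noteq> \<infinity>" by auto
    then show ?thesis using axis_in_Xprod[OF data i s(1)] by blast
  next
    case 3
    obtain v where v: "v \<in> Xprod P" "bf P \<alpha> v \<noteq> \<infinity>" using feasible_point 3 by blast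
    have "nodefun P \<alpha> (v $ \<alpha>) \<noteq> \<infinity>" using v(2) by (simp add: bf_node[OF 3(1)])
    from closed_convex_fun_affine_minorant[OF node_subspace[OF 3(1)] nodefun_closed[OF 3(1)]
        Xprod_coord[OF v(1) 3(1)] this]
    obtain s b where s: "s \<in> node_space P \<alpha>" "\<forall>y\<in>node_space P \<alpha>. ereal (s \<bullet> y - b) \<le> nodefun P \<alpha> y"
      by blast
    have "conj_at n w \<alpha> (axis \<alpha> s) \<le> ereal b"
      unfolding conj_at_def bfn_other[OF 3(2)] bf_node[OF 3(1)]
      by (rule conjugate_axis_le[OF 3(1), of _ _ "nodefun P \<alpha>"]) (use s(2) in auto)
    then have "conj_at n w \<alpha> (axis \<alpha> s) \<noteq> \<infinity>" by auto
    then show ?thesis using axis_in_Xprod[OF data 3(1) s(1)] by blast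
  qed
qed

lemma conj_at_cong:
  assumes "\<And>y. \<alpha> \<in> nodes4 P \<Longrightarrow> y \<in> node_space P \<alpha> \<Longrightarrow> g n w \<alpha> y = g n' w' \<alpha> y"
  shows "conj_at n w \<alpha> = conj_at n' w' \<alpha>"
proof (rule ext)
  fix u
  show "conj_at n w \<alpha> u = conj_at n' w' \<alpha> u"
    unfolding conj_at_def
    by (rule conjugate_cong) (use assms Xprod_coord nodes4_subset in \<open>auto simp: bfn_def\<close>)
qed

lemma valid_in_Xprod: "valid n w \<Longrightarrow> \<alpha> \<in> blocks \<Longrightarrow> z n w \<alpha> \<in> Xprod P"
  unfolding valid_def by (auto simp: perp_iff)

lemma x_in_Xprod: "valid n w \<Longrightarrow> x n w \<in> Xprod P"
  unfolding x_def
  by (intro subspace_diff[OF Xprod_subspace] subspace_sum[OF Xprod_subspace] xbar_in valid_in_Xprod)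

text \<open>
  The dual vectors of the other nodes have no component in coordinate \<open>i\<close>; hence the point at which a
  subgradient update linearizes is the coordinate \<open>i\<close> of the current \<open>x\<close>.
\<close>

lemma x_coord:
  assumes v: "valid n w" and i: "i \<in> nodes P"
  shows "x n w $ i = (xbar P - vH P z n w - z n w i) $ i"
proof -
  have zero: "z n w k $ i = 0" if "k \<in> nodes P" "k \<noteq> i" for k
    using v that by (auto simp: valid_def)
  have "(\<Sum>\<alpha>\<in>blocks. z n w \<alpha>) = vH P z n w + (\<Sum>\<alpha>\<in>nodes P. z n w \<alpha>)"
    unfolding vH_def by (rule sum.union_disjoint) (use nodes_edges_disjoint in auto)
  moreover have "(\<Sum>\<alpha>\<in>nodes P. z n w \<alpha>) $ i = (\<Sum>\<alpha>\<in>{i}. z n w \<alpha> $ i)"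
    unfolding sum_component by (rule sum.mono_neutral_right) (use zero i in auto)
  ultimately show ?thesis by (simp add: x_def)
qed

section \<open>The inequality produced by an update\<close>

lemma step_facts:
  assumes "n \<ge> 1" "w \<in> {1..wbar}"
  shows "S n w \<noteq> {}" "S n w \<subseteq> blocks"
    "S n w \<subseteq> nodes4 P \<Longrightarrow> i \<in> S n w \<Longrightarrow> subgradient_update P z g n w i"
    "\<not> S n w \<subseteq> nodes4 P \<Longrightarrow> block_update P z g S n w"
    "i \<in> nodes4 P \<Longrightarrow> i \<notin> S n w \<or> \<not> S n w \<subseteq> nodes4 P \<Longrightarrow> y \<in> node_space P i \<Longrightarrow> g n w i y = g n (w - 1) i y"
    "\<alpha> \<in> blocks \<Longrightarrow> \<alpha> \<notin> S n w \<Longrightarrow> z n w \<alpha> = z n (w - 1) \<alpha>"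
proof -
  have I: "inner_step P z g S En n w" using run assms unfolding dykstra_run_def by blast
  have E: "En n \<subseteq> edges P" using En_eq assms by blast
  show "S n w \<noteq> {}" "S n w \<subseteq> blocks"
    "S n w \<subseteq> nodes4 P \<Longrightarrow> i \<in> S n w \<Longrightarrow> subgradient_update P z g n w i"
    "\<not> S n w \<subseteq> nodes4 P \<Longrightarrow> block_update P z g S n w"
    "i \<in> nodes4 P \<Longrightarrow> i \<notin> S n w \<or> \<not> S n w \<subseteq> nodes4 P \<Longrightarrow> y \<in> node_space P i \<Longrightarrow> g n w i y = g n (w - 1) i y"
    "\<alpha> \<in> blocks \<Longrightarrow> \<alpha> \<notin> S n w \<Longrightarrow> z n w \<alpha> = z n (w - 1) \<alpha>"
    using I E unfolding inner_step_def by (auto split: if_splits)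
qed

text \<open>
  The last inequality bounds the conjugate from before the update as well.  In a subgradient update the
  two conjugates are not comparable, since the new one is finite at a single point only; both are
  nevertheless bounded below by the same affine function.
\<close>

definition update_inequality :: "nat \<Rightarrow> nat \<Rightarrow> 'k \<Rightarrow> bool" where
  "update_inequality n w \<alpha> \<longleftrightarrow> \<bar>conj_at n w \<alpha> (z n w \<alpha>)\<bar> \<noteq> \<infinity> \<and>
     (\<forall>y\<in>Xprod P.
        conj_at n w \<alpha> (z n w \<alpha>) + ereal (x n w \<bullet> (y - z n w \<alpha>)) \<le> conj_at n w \<alpha> y \<and>
        conj_at n w \<alpha> (z n w \<alpha>) + ereal (x n w \<bullet> (y - z n w \<alpha>)) \<le> conj_at n (w - 1) \<alpha> y)"

text \<open>
  The minorants are unchanged, so both parts of \<open>update_inequality\<close> are the optimality condition of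
  the joint minimization, whose residual is \<open>x n w\<close>.
\<close>

lemma block_step:
  assumes n: "n \<ge> 1" and w: "w \<in> {1..wbar}" and v: "valid n (w - 1)" and S: "\<not> S n w \<subseteq> nodes4 P"
  shows "valid n w" "\<alpha> \<in> S n w \<Longrightarrow> update_inequality n w \<alpha>"
proof -
  note sf = step_facts[OF n w]
  have geq: "g n w i y = g n (w - 1) i y" if "i \<in> nodes4 P" "y \<in> node_space P i" for i y
    using sf(5) S that by blast
  have Ceq: "conj_at n w \<beta> = conj_at n (w - 1) \<beta>" for \<beta>
    by (rule conj_at_cong) (use geq in blast)
  define b where "b = xbar P - (\<Sum>\<alpha>\<in>(nodes P \<union> edges P) - S n w. z n (w - 1) \<alpha>)"
  have argmin: "is_arg_min (\<lambda>u. ereal ((norm (b - (\<Sum>\<alpha>\<in>S n w. u \<alpha>)))\<^sup>2 / 2)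
            + (\<Sum>\<alpha>\<in>S n w. conjugate (Xprod P) (bfn P g n w \<alpha>) (u \<alpha>)))
       (\<lambda>u. \<forall>\<alpha>\<in>S n w. u \<alpha> \<in> Xprod P) (z n w)"
    using sf(4)[OF S] unfolding block_update_def b_def .
  have dom: "\<exists>v\<in>Xprod P. bfn P g n w \<alpha> v \<noteq> \<infinity>" if "\<alpha> \<in> S n w" for \<alpha>
    using bfn_dom sf(2) that by blast
  have proper: "\<exists>u\<in>Xprod P. conjugate (Xprod P) (bfn P g n w \<alpha>) u \<noteq> \<infinity>" if "\<alpha> \<in> S n w" for \<alpha>
    using conj_at_proper[OF v, of \<alpha>] sf(2) that Ceq[of \<alpha>] unfolding conj_at_def by auto
  have zX: "z n w \<alpha> \<in> Xprod P" if "\<alpha> \<in> S n w" for \<alpha> using argmin that unfolding is_arg_min_def by blast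
  have bx: "b - (\<Sum>\<alpha>\<in>S n w. z n w \<alpha>) = x n w"
  proof -
    have "(\<Sum>\<alpha>\<in>blocks. z n w \<alpha>) = (\<Sum>\<alpha>\<in>blocks - S n w. z n w \<alpha>) + (\<Sum>\<alpha>\<in>S n w. z n w \<alpha>)"
      using sf(2) by (intro sum.subset_diff) auto
    moreover have "(\<Sum>\<alpha>\<in>blocks - S n w. z n w \<alpha>) = (\<Sum>\<alpha>\<in>blocks - S n w. z n (w - 1) \<alpha>)"
      using sf(6) by (intro sum.cong) auto
    ultimately show ?thesis by (simp add: b_def x_def Un_commute algebra_simps)
  qed
  note B = block_minimizer_subgradients[OF finite subspace_imp_convex[OF Xprod_subspace] argmin dom proper,
      folded conj_at_def, unfolded bx]
  have fin: "\<bar>conj_at n w \<alpha> (z n w \<alpha>)\<bar> \<noteq> \<infinity>" if "\<alpha> \<in> S n w" for \<alpha> using B(1) that by simp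
  show "update_inequality n w \<alpha>" if "\<alpha> \<in> S n w"
    using fin[OF that] B(2)[OF _ _ that] Ceq unfolding update_inequality_def by simp
  show "valid n w"
    unfolding valid_def
  proof (intro conjI ballI allI impI)
    fix i assume i: "i \<in> nodes P"
    show "z n w i \<in> Xprod P" using zX sf(6)[of i] valid_in_Xprod[OF v, of i] i by (cases "i \<in> S n w") auto
    fix j assume j: "j \<noteq> i"
    show "z n w i $ j = 0"
    proof (cases "i \<in> S n w")
      case True
      show ?thesis by (rule conj_at_node_support[OF i zX[OF True] _ j, of n w]) (use fin[OF True] in auto)
    qed (use sf(6)[of i] v i j in \<open>auto simp: valid_def\<close>)
  next
    fix \<alpha> assume a: "\<alpha> \<in> edges P"
    show "z n w \<alpha> \<in> perp P (hyper P \<alpha>)"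
    proof (cases "\<alpha> \<in> S n w")
      case True
      show ?thesis by (rule perp_of_conj_at[OF a zX[OF True], of n w]) (use fin[OF True] in auto)
    qed (use sf(6)[of \<alpha>] v a in \<open>auto simp: valid_def\<close>)
  next
    fix i assume i: "i \<in> nodes4 P"
    have "convex_on (node_space P i) (g n (w - 1) i)" using v i unfolding valid_def by blast
    then show "convex_on (node_space P i) (g n w i)"
      using convex_on_transfer geq[OF i] by metis
    fix y assume "y \<in> node_space P i"
    then show "ereal (g n w i y) \<le> nodefun P i y" using geq[OF i] v i unfolding valid_def by simp
  qed
qed

text \<open>
  Let \<open>p\<close> be the proximal point and \<open>m\<close> the maximum of the old minorant and the new linear piece.
  The conjugate of the new affine minorant is supported at the new dual vector, with value
  \<open>z \<bullet> x - m p\<close>.  As \<open>m\<close> dominates the old minorant, the old conjugate at \<open>y\<close> is at least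
  \<open>y \<bullet> x - m p\<close>, which is the affine function in \<open>update_inequality\<close>.  The last claim sharpens this
  at the old dual vector: there the old conjugate is at least the Fenchel-Young value at the old point
  \<open>q\<close>, while \<open>m p\<close> is at least the linear piece, which at \<open>q\<close> exceeds the old minorant by the
  difference \<open>real_of_ereal (nodefun P i q) - g n (w - 1) i q\<close>.
\<close>

lemma subgradient_step:
  assumes n: "n \<ge> 1" and w: "w \<in> {1..wbar}" and v: "valid n (w - 1)" and S: "S n w \<subseteq> nodes4 P"
  shows "valid n w" "i \<in> S n w \<Longrightarrow> update_inequality n w i"
    "i \<in> S n w \<Longrightarrow> q = x n (w - 1) $ i \<Longrightarrow> \<exists>s\<in>subdifferential (node_space P i) (nodefun P i) q.
      conj_at n w i (z n w i) + ereal (x n w \<bullet> (z n (w - 1) i - z n w i))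
        + ereal (real_of_ereal (nodefun P i q) - g n (w - 1) i q
                 - norm (s - z n (w - 1) i $ i) * norm (x n w - x n (w - 1)))
      \<le> conj_at n (w - 1) i (z n (w - 1) i)"
proof -
  note sf = step_facts[OF n w]
  have disj: "\<alpha> \<notin> S n w" if "\<alpha> \<in> edges P" for \<alpha>
    using that S nodes4_subset nodes_edges_disjoint by blast
  have vHeq: "vH P z n w = vH P z n (w - 1)"
    unfolding vH_def by (rule sum.cong) (use sf(6) disj in auto)
  have main: "z n w i \<in> Xprod P \<and> (\<forall>j. j \<noteq> i \<longrightarrow> z n w i $ j = 0)
    \<and> convex_on (node_space P i) (g n w i)
    \<and> (\<forall>y\<in>node_space P i. ereal (g n w i y) \<le> nodefun P i y)
    \<and> (\<exists>p m s. s \<in> subdifferential (node_space P i) (nodefun P i) (x n (w - 1) $ i)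
        \<and> (\<forall>y. m y = max (g n (w - 1) i y)
              (real_of_ereal (nodefun P i (x n (w - 1) $ i)) + s \<bullet> (y - x n (w - 1) $ i)))
        \<and> p \<in> node_space P i \<and> z n w i $ i = (xbar P - vH P z n w) $ i - p
        \<and> (\<forall>y\<in>node_space P i. g n w i y = m p + (y - p) \<bullet> (z n w i $ i)))"
    if i: "i \<in> S n w" for i
  proof -
    have i4: "i \<in> nodes4 P" and iN: "i \<in> nodes P" using S i nodes4_subset by auto
    note sub = node_subspace[OF iN]
    define c where "c = (xbar P - vH P z n (w - 1)) $ i"
    define q where "q = (xbar P - vH P z n (w - 1) - z n (w - 1) i) $ i"
    have qx: "q = x n (w - 1) $ i" unfolding q_def using x_coord[OF v iN] by simp
    have "subgradient_update P z g n w i" using sf(3) S i by blast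
    then obtain s p m where s: "s \<in> subdifferential (node_space P i) (nodefun P i) q"
      and m_def: "m = (\<lambda>x. max (g n (w - 1) i x) (real_of_ereal (nodefun P i q) + s \<bullet> (x - q)))"
      and argmin: "is_arg_min (\<lambda>x. (norm (c - x))\<^sup>2 / 2 + m x) (\<lambda>x. x \<in> node_space P i) p"
      and g: "\<forall>x\<in>node_space P i. g n w i x = m p + (x - p) \<bullet> (c - p)"
      and z: "z n w i $ i = c - p" "\<forall>j. j \<noteq> i \<longrightarrow> z n w i $ j = 0"
      unfolding subgradient_update_def Let_def c_def[symmetric] q_def[symmetric] by blast
    have p: "p \<in> node_space P i" using argmin unfolding is_arg_min_def by blast
    have qX: "q \<in> node_space P i" using qx x_in_Xprod[OF v] Xprod_coord iN by simp
    have "vH P z n (w - 1) \<in> Xprod P"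
      unfolding vH_def by (intro subspace_sum[OF Xprod_subspace] valid_in_Xprod[OF v]) auto
    then have cX: "c \<in> node_space P i"
      unfolding c_def by (intro Xprod_coord[OF _ iN] subspace_diff[OF Xprod_subspace] xbar_in)
    have gold: "convex_on (node_space P i) (g n (w - 1) i)"
        "\<forall>y\<in>node_space P i. ereal (g n (w - 1) i y) \<le> nodefun P i y"
      using v i4 unfolding valid_def by blast+
    have cm: "convex_on (node_space P i) m"
    proof -
      have "max (g n (w - 1) i (u *\<^sub>R a + t *\<^sub>R b)) (real_of_ereal (nodefun P i q) + s \<bullet> (u *\<^sub>R a + t *\<^sub>R b - q))
        \<le> u * m a + t * m b"
        if ab: "a \<in> node_space P i" "b \<in> node_space P i" and ut: "0 \<le> u" "0 \<le> t" "u + t = 1" for a b u t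
      proof (rule max.boundedI)
        have "u * g n (w - 1) i a + t * g n (w - 1) i b \<le> u * m a + t * m b"
          using ut by (intro add_mono mult_left_mono) (auto simp: m_def)
        then show "g n (w - 1) i (u *\<^sub>R a + t *\<^sub>R b) \<le> u * m a + t * m b"
          using gold(1) ab ut unfolding convex_on_def by fastforce
        have t: "t = 1 - u" using ut by simp
        have "real_of_ereal (nodefun P i q) + s \<bullet> (u *\<^sub>R a + t *\<^sub>R b - q)
          = u * (real_of_ereal (nodefun P i q) + s \<bullet> (a - q)) + t * (real_of_ereal (nodefun P i q) + s \<bullet> (b - q))"
          unfolding t by (simp add: algebra_simps inner_diff_right inner_add_right)
        also have "\<dots> \<le> u * m a + t * m b"
          using ut by (intro add_mono mult_left_mono) (auto simp: m_def)
        finally show "real_of_ereal (nodefun P i q) + s \<bullet> (u *\<^sub>R a + t *\<^sub>R b - q) \<le> u * m a + t * m b" .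
      qed
      then show ?thesis
        using subspace_imp_convex[OF sub] unfolding convex_on_def m_def by blast
    qed
    have mf: "ereal (m y) \<le> nodefun P i y" if y: "y \<in> node_space P i" for y
    proof -
      have "nodefun P i q + ereal (s \<bullet> (y - q)) \<le> nodefun P i y"
        using s y unfolding subdifferential_def by blast
      then have "ereal (real_of_ereal (nodefun P i q) + s \<bullet> (y - q)) \<le> nodefun P i y"
        by (subst (asm) nodefun4_finite[OF i4 qX]) simp
      then show ?thesis using gold(2) y unfolding m_def by (simp add: max_def)
    qed
    have gf: "ereal (g n w i y) \<le> nodefun P i y" if y: "y \<in> node_space P i" for y
    proof -
      have "g n w i y \<le> m y"
        using prox_minimizer_subgradient[OF cm argmin y] g y by (simp add: inner_commute)
      then show ?thesis using mf[OF y] by (meson ereal_less_eq(3) order_trans)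
    qed
    have cg: "convex_on (node_space P i) (g n w i)"
    proof (rule convex_on_transfer)
      show "convex_on (node_space P i) (\<lambda>x. m p + (x - p) \<bullet> (c - p))"
      proof -
        have "m p + (u *\<^sub>R a + t *\<^sub>R b - p) \<bullet> (c - p) = u * (m p + (a - p) \<bullet> (c - p)) + t * (m p + (b - p) \<bullet> (c - p))"
          if "u + t = 1" for a b u t
        proof -
          have t: "t = 1 - u" using that by simp
          show ?thesis unfolding t by (simp add: algebra_simps inner_diff_left inner_add_left)
        qed
        then show ?thesis using subspace_imp_convex[OF sub] unfolding convex_on_def by simp
      qed
    qed (use g in blast)
    have "z n w i = axis i (c - p)" using z by (auto simp: vec_eq_iff axis_def)
    then have zX: "z n w i \<in> Xprod P"
      using axis_in_Xprod[OF data iN subspace_diff[OF sub cX p]] by simp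
    have zp: "z n w i $ i = (xbar P - vH P z n w) $ i - p" unfolding vHeq z(1) c_def by simp
    have gp: "\<forall>y\<in>node_space P i. g n w i y = m p + (y - p) \<bullet> (z n w i $ i)" using g z(1) by simp
    show ?thesis
      using zX z(2) cg gf
      by (intro conjI exI[of _ p] exI[of _ m] exI[of _ s] zp p s[unfolded qx] gp) (auto simp: m_def qx)
  qed
  show valid: "valid n w"
    unfolding valid_def
  proof (intro conjI ballI allI impI)
    fix i assume i: "i \<in> nodes P"
    show "z n w i \<in> Xprod P" using main[of i] sf(6)[of i] valid_in_Xprod[OF v, of i] i by (cases "i \<in> S n w") auto
    fix j assume j: "j \<noteq> i"
    show "z n w i $ j = 0"
      using main[of i] sf(6)[of i] v i j by (cases "i \<in> S n w") (auto simp: valid_def)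
  next
    fix \<alpha> assume a: "\<alpha> \<in> edges P"
    then show "z n w \<alpha> \<in> perp P (hyper P \<alpha>)" using sf(6)[of \<alpha>] disj v by (auto simp: valid_def)
  next
    fix i assume i: "i \<in> nodes4 P"
    have old: "convex_on (node_space P i) (g n (w - 1) i)"
      "\<And>y. y \<in> node_space P i \<Longrightarrow> ereal (g n (w - 1) i y) \<le> nodefun P i y" using v i unfolding valid_def by blast+
    show "convex_on (node_space P i) (g n w i)"
    proof (cases "i \<in> S n w")
      case False
      then show ?thesis using convex_on_transfer[OF old(1)] sf(5)[OF i] by blast
    qed (use main in blast)
    fix y assume y: "y \<in> node_space P i"
    show "ereal (g n w i y) \<le> nodefun P i y"
    proof (cases "i \<in> S n w")
      case False
      then show ?thesis using old(2)[OF y] sf(5)[OF i _ y] by simp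
    qed (use main y in blast)
  qed
  assume i: "i \<in> S n w"
  have i4: "i \<in> nodes4 P" and iN: "i \<in> nodes P" using S i nodes4_subset by auto
  define q' where "q' = x n (w - 1) $ i"
  from main[OF i] obtain p m s where s: "s \<in> subdifferential (node_space P i) (nodefun P i) q'"
    and m: "\<And>y. m y = max (g n (w - 1) i y) (real_of_ereal (nodefun P i q') + s \<bullet> (y - q'))"
    and p: "p \<in> node_space P i" and zp: "z n w i $ i = (xbar P - vH P z n w) $ i - p"
    and g: "\<And>y. y \<in> node_space P i \<Longrightarrow> g n w i y = m p + (y - p) \<bullet> (z n w i $ i)"
    and zX: "z n w i \<in> Xprod P"
    unfolding q'_def by blast
  have xp: "x n w $ i = p" using x_coord[OF valid iN] zp by simp
  have xX: "x n w \<in> Xprod P" by (rule x_in_Xprod[OF valid])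
  have zx: "z n w i \<bullet> v = z n w i $ i \<bullet> v $ i" for v
    by (rule inner_supported) (use valid iN in \<open>auto simp: valid_def\<close>)
  have Cz: "conj_at n w i (z n w i) = ereal (z n w i $ i \<bullet> p - m p)"
  proof (rule antisym)
    show "conj_at n w i (z n w i) \<le> ereal (z n w i $ i \<bullet> p - m p)"
      unfolding conj_at_def bfn_nodes4[OF i4]
    proof (rule conjugate_le)
      fix v assume "v \<in> Xprod P"
      then have "g n w i (v $ i) = m p + (v $ i - p) \<bullet> (z n w i $ i)" using g Xprod_coord iN by blast
      then show "ereal (z n w i \<bullet> v) - ereal (g n w i (v $ i)) \<le> ereal (z n w i $ i \<bullet> p - m p)"
        by (simp add: zx inner_diff_left inner_commute[of "z n w i $ i"])
    qed
    show "ereal (z n w i $ i \<bullet> p - m p) \<le> conj_at n w i (z n w i)"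
      using conjugate_ge[OF xX, of "z n w i" "bfn P g n w i"] g[OF p]
      by (simp add: conj_at_def bfn_nodes4[OF i4] zx xp)
  qed
  have key: "conj_at n w i (z n w i) + ereal (x n w \<bullet> (y - z n w i)) = ereal (y \<bullet> x n w - m p)" for y
    by (simp add: Cz inner_diff_right inner_commute[of "x n w"] zx xp)
  show "update_inequality n w i"
    unfolding update_inequality_def key
  proof (intro conjI ballI)
    show "\<bar>conj_at n w i (z n w i)\<bar> \<noteq> \<infinity>" by (simp add: Cz)
    fix y
    show "ereal (y \<bullet> x n w - m p) \<le> conj_at n w i y"
      using conjugate_ge[OF xX, of y "bfn P g n w i"] g[OF p]
      by (simp add: conj_at_def bfn_nodes4[OF i4] xp)
    have "ereal (y \<bullet> x n w - m p) \<le> ereal (y \<bullet> x n w - g n (w - 1) i p)" by (simp add: m)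
    also have "\<dots> \<le> conj_at n (w - 1) i y"
      using conjugate_ge[OF xX, of y "bfn P g n (w - 1) i"]
      by (simp add: conj_at_def bfn_nodes4[OF i4] xp)
    finally show "ereal (y \<bullet> x n w - m p) \<le> conj_at n (w - 1) i y" .
  qed
  assume q: "q = x n (w - 1) $ i"
  then have qq: "q' = q" by (simp add: q'_def)
  let ?u = "z n (w - 1) i"
  have ux: "?u \<bullet> v = ?u $ i \<bullet> v $ i" for v
    by (rule inner_supported) (use assms(3) iN in \<open>auto simp: valid_def\<close>)
  have "- (s - ?u $ i) \<bullet> (p - q) \<le> norm (s - ?u $ i) * norm (p - q)"
    using norm_cauchy_schwarz[of "- (s - ?u $ i)" "p - q"] by (simp add: norm_minus_commute[of s])
  also have "\<dots> \<le> norm (s - ?u $ i) * norm (x n w - x n (w - 1))"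
    using Finite_Cartesian_Product.norm_nth_le[of "x n w - x n (w - 1)" i]
    by (intro mult_left_mono) (auto simp: q xp)
  finally have cs: "- (s - ?u $ i) \<bullet> (p - q) \<le> norm (s - ?u $ i) * norm (x n w - x n (w - 1))" .
  have "real_of_ereal (nodefun P i q) + s \<bullet> (p - q) \<le> m p" unfolding m qq by simp
  then have "?u \<bullet> x n w - m p + (real_of_ereal (nodefun P i q) - g n (w - 1) i q
                 - norm (s - ?u $ i) * norm (x n w - x n (w - 1)))
      \<le> ?u \<bullet> x n (w - 1) - g n (w - 1) i q"
    using cs unfolding ux xp q by (simp add: inner_diff_left inner_diff_right)
  also have "ereal (?u \<bullet> x n (w - 1) - g n (w - 1) i q) \<le> conj_at n (w - 1) i ?u"
    using conjugate_ge[OF x_in_Xprod[OF assms(3)], of ?u "bfn P g n (w - 1) i"]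
    by (simp add: conj_at_def bfn_nodes4[OF i4] q)
  finally have "conj_at n w i (z n w i) + ereal (x n w \<bullet> (?u - z n w i))
        + ereal (real_of_ereal (nodefun P i q) - g n (w - 1) i q
                 - norm (s - ?u $ i) * norm (x n w - x n (w - 1)))
      \<le> conj_at n (w - 1) i ?u"
    unfolding key by simp
  then show "\<exists>s\<in>subdifferential (node_space P i) (nodefun P i) q.
      conj_at n w i (z n w i) + ereal (x n w \<bullet> (z n (w - 1) i - z n w i))
        + ereal (real_of_ereal (nodefun P i q) - g n (w - 1) i q
                 - norm (s - z n (w - 1) i $ i) * norm (x n w - x n (w - 1)))
      \<le> conj_at n (w - 1) i (z n (w - 1) i)"
    using s unfolding qq by blast
qed

section \<open>Descent of the dual value along the algorithm\<close>

lemma carry_facts: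
  assumes "n \<ge> 1"
  shows "i \<in> nodes P \<Longrightarrow> z (n + 1) 0 i = z n wbar i" "vH P z (n + 1) 0 = vH P z n wbar"
    "i \<in> nodes4 P \<Longrightarrow> y \<in> node_space P i \<Longrightarrow> g (n + 1) 0 i y = g n wbar i y"
  using run assms unfolding dykstra_run_def carry_over_def by blast+

lemma edge_facts:
  assumes "n \<ge> 1"
  shows "connects P (En n)" "\<alpha> \<in> edges P \<Longrightarrow> \<alpha> \<notin> En n \<Longrightarrow> z n 0 \<alpha> = 0"
    "\<alpha> \<in> edges P \<Longrightarrow> z n 0 \<alpha> \<in> perp P (hyper P \<alpha>)"
  using run assms unfolding dykstra_run_def edge_step_def by blast+

lemma valid_update:
  assumes "n \<ge> 1" "w \<in> {1..wbar}" "valid n (w - 1)"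
  shows "valid n w"
  using block_step(1)[OF assms] subgradient_step(1)[OF assms] by blast

lemma valid_within:
  assumes "n \<ge> 1" "valid n 0"
  shows "w \<le> wbar \<Longrightarrow> valid n w"
proof (induction w)
  case (Suc w)
  then show ?case using valid_update[OF assms(1), of "Suc w"] by simp
qed (use assms in simp)

lemma valid_start: "n \<ge> 1 \<Longrightarrow> valid n 0"
proof (induction n rule: nat_induct_at_least)
  case base
  have "initialization P z g" using run unfolding dykstra_run_def by blast
  then show ?case
    using edge_facts(3)[of 1] unfolding initialization_def valid_def by simp
next
  case (Suc n)
  have v: "valid n wbar" using valid_within[OF Suc] by simp
  have "convex_on (node_space P i) (g (n + 1) 0 i)" if i: "i \<in> nodes4 P" for i
  proof (rule convex_on_transfer)
    show "convex_on (node_space P i) (g n wbar i)" using v i unfolding valid_def by blast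
  qed (rule carry_facts(3)[OF Suc(1) i])
  moreover have "ereal (g (n + 1) 0 i y) \<le> nodefun P i y" if "i \<in> nodes4 P" "y \<in> node_space P i" for i y
    using carry_facts(3)[OF Suc(1) that] v that unfolding valid_def by simp
  moreover have "z (n + 1) 0 i \<in> Xprod P" "j \<noteq> i \<Longrightarrow> z (n + 1) 0 i $ j = 0" if "i \<in> nodes P" for i j
    using carry_facts(1)[OF Suc(1) that] v that unfolding valid_def by auto
  ultimately show ?case using edge_facts(3)[of "n + 1"] unfolding valid_def by simp
qed

lemma valid_all: "n \<ge> 1 \<Longrightarrow> w \<le> wbar \<Longrightarrow> valid n w"
  using valid_within valid_start by blast

lemma update_inequality_holds:
  assumes "n \<ge> 1" "w \<in> {1..wbar}" "\<alpha> \<in> S n w"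
  shows "update_inequality n w \<alpha>"
proof -
  have "valid n (w - 1)" by (rule valid_all) (use assms in auto)
  then show ?thesis
    using block_step(2)[OF assms(1,2) _ _ assms(3)] subgradient_step(2)[OF assms(1,2) _ _ assms(3)] by blast
qed

lemma conj_at_carry: "n \<ge> 1 \<Longrightarrow> conj_at (n + 1) 0 \<alpha> = conj_at n wbar \<alpha>"
  using conj_at_cong carry_facts(3) by blast

lemma x_carry:
  assumes "n \<ge> 1"
  shows "x (n + 1) 0 = x n wbar"
proof -
  have "(\<Sum>\<alpha>\<in>blocks. z m w \<alpha>) = vH P z m w + (\<Sum>\<alpha>\<in>nodes P. z m w \<alpha>)" for m w
    unfolding vH_def by (rule sum.union_disjoint) (use nodes_edges_disjoint in auto)
  then show ?thesis using carry_facts(1,2)[OF assms] by (simp add: x_def)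
qed

lemma unchanged_block:
  assumes "n \<ge> 1" "w \<in> {1..wbar}" "\<alpha> \<in> blocks" "\<alpha> \<notin> S n w"
  shows "z n w \<alpha> = z n (w - 1) \<alpha>" "conj_at n w \<alpha> = conj_at n (w - 1) \<alpha>"
  using step_facts(5,6)[OF assms(1,2)] assms(3,4) by (blast intro: conj_at_cong)+

definition dual_finite :: "nat \<Rightarrow> nat \<Rightarrow> bool" where
  "dual_finite n w \<longleftrightarrow> (\<forall>\<alpha>\<in>blocks. conj_at n w \<alpha> (z n w \<alpha>) \<noteq> \<infinity>)"

definition conj_val :: "nat \<Rightarrow> nat \<Rightarrow> 'k \<Rightarrow> real" where
  "conj_val n w \<alpha> = real_of_ereal (conj_at n w \<alpha> (z n w \<alpha>))"

definition neg_dual :: "nat \<Rightarrow> nat \<Rightarrow> real" where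
  "neg_dual n w = (norm (x n w))\<^sup>2 / 2 - (norm (xbar P))\<^sup>2 / 2 + (\<Sum>\<alpha>\<in>blocks. conj_val n w \<alpha>)"

lemma conj_at_conj_val:
  assumes "dual_finite n w" "\<alpha> \<in> blocks"
  shows "conj_at n w \<alpha> (z n w \<alpha>) = ereal (conj_val n w \<alpha>)"
  using assms conj_at_not_MInf[OF assms(2)] unfolding dual_finite_def conj_val_def
  by (cases "conj_at n w \<alpha> (z n w \<alpha>)") auto

lemma dualn_fin:
  assumes "dual_finite n w"
  shows "- dualn P g n w (z n w) = ereal (neg_dual n w)"
proof -
  have "(\<Sum>\<alpha>\<in>blocks. conj_at n w \<alpha> (z n w \<alpha>)) = ereal (\<Sum>\<alpha>\<in>blocks. conj_val n w \<alpha>)"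
    using conj_at_conj_val[OF assms] by simp
  then show ?thesis
    unfolding dual_of_def conj_at_def[symmetric] x_def[symmetric] by (simp add: neg_dual_def)
qed

lemma dualn_not_fin:
  assumes "\<not> dual_finite n w"
  shows "- dualn P g n w (z n w) = \<infinity>"
proof -
  have "(\<Sum>\<alpha>\<in>blocks. conj_at n w \<alpha> (z n w \<alpha>)) = \<infinity>"
    using assms unfolding dual_finite_def by (auto simp: sum_Pinfty)
  then show ?thesis unfolding dual_of_def conj_at_def[symmetric] by simp
qed

text \<open>
  Adding the update inequalities at the old dual vectors bounds the change of the conjugates by
  \<open>x n w \<bullet> (x n w - x n (w - 1))\<close>; completing the square with the quadratic part leaves
  \<open>\<parallel>x n w - x n (w - 1)\<parallel>\<^sup>2 / 2\<close>, and any slack in one of the inequalities is gained in addition.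
\<close>

lemma descent_slack:
  assumes n: "n \<ge> 1" and w: "w \<in> {1..wbar}" and fin: "dual_finite n (w - 1)" and i: "i \<in> S n w"
    and slack: "conj_at n w i (z n w i) + ereal (x n w \<bullet> (z n (w - 1) i - z n w i)) + ereal r
      \<le> conj_at n (w - 1) i (z n (w - 1) i)"
  shows "dual_finite n w" "neg_dual n w + (norm (x n w - x n (w - 1)))\<^sup>2 / 2 + r \<le> neg_dual n (w - 1)"
proof -
  note un = unchanged_block[OF n w]
  have v: "valid n (w - 1)" by (rule valid_all) (use n w in auto)
  show finw: "dual_finite n w"
    unfolding dual_finite_def
  proof
    fix \<alpha> assume a: "\<alpha> \<in> blocks"
    show "conj_at n w \<alpha> (z n w \<alpha>) \<noteq> \<infinity>"
      using update_inequality_holds[OF n w, of \<alpha>] un[OF a] fin a unfolding update_inequality_def dual_finite_def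
      by (cases "\<alpha> \<in> S n w") auto
  qed
  have "conj_val n w \<alpha> + x n w \<bullet> (z n (w - 1) \<alpha> - z n w \<alpha>) + (if \<alpha> = i then r else 0) \<le> conj_val n (w - 1) \<alpha>"
    if a: "\<alpha> \<in> blocks" for \<alpha>
  proof (cases "\<alpha> \<in> S n w")
    case True
    have "conj_at n w \<alpha> (z n w \<alpha>) + ereal (x n w \<bullet> (z n (w - 1) \<alpha> - z n w \<alpha>)) \<le> conj_at n (w - 1) \<alpha> (z n (w - 1) \<alpha>)"
      using update_inequality_holds[OF n w True] valid_in_Xprod[OF v a] unfolding update_inequality_def by blast
    then show ?thesis
      using slack conj_at_conj_val[OF finw a] conj_at_conj_val[OF fin a] by auto
  next
    case False
    then show ?thesis using un[OF a False] i by (auto simp: conj_val_def)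
  qed
  then have "(\<Sum>\<alpha>\<in>blocks. conj_val n w \<alpha> + x n w \<bullet> (z n (w - 1) \<alpha> - z n w \<alpha>) + (if \<alpha> = i then r else 0))
     \<le> (\<Sum>\<alpha>\<in>blocks. conj_val n (w - 1) \<alpha>)"
    by (rule sum_mono)
  moreover have "(\<Sum>\<alpha>\<in>blocks. if \<alpha> = i then r else 0) = r"
    using i step_facts(2)[OF n w] by (subst sum.delta) auto
  moreover have "(\<Sum>\<alpha>\<in>blocks. x n w \<bullet> (z n (w - 1) \<alpha> - z n w \<alpha>)) = x n w \<bullet> (x n w - x n (w - 1))"
    by (simp add: x_def inner_sum_right[symmetric] sum_subtractf)
  ultimately have "(\<Sum>\<alpha>\<in>blocks. conj_val n w \<alpha>) + x n w \<bullet> (x n w - x n (w - 1)) + r \<le> (\<Sum>\<alpha>\<in>blocks. conj_val n (w - 1) \<alpha>)"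
    by (simp add: sum.distrib)
  moreover have "(norm (x n w - x n (w - 1)))\<^sup>2 = 2 * (x n w \<bullet> (x n w - x n (w - 1))) - (norm (x n w))\<^sup>2 + (norm (x n (w - 1)))\<^sup>2"
    unfolding power2_norm_eq_inner by (simp add: inner_diff_left inner_diff_right inner_commute)
  ultimately show "neg_dual n w + (norm (x n w - x n (w - 1)))\<^sup>2 / 2 + r \<le> neg_dual n (w - 1)"
    unfolding neg_dual_def by argo
qed

lemma descent_step:
  assumes n: "n \<ge> 1" and w: "w \<in> {1..wbar}" and fin: "dual_finite n (w - 1)"
  shows "dual_finite n w" "neg_dual n w + (norm (x n w - x n (w - 1)))\<^sup>2 / 2 \<le> neg_dual n (w - 1)"
proof -
  obtain i where i: "i \<in> S n w" using step_facts(1)[OF n w] by blast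
  have "z n (w - 1) i \<in> Xprod P"
    using valid_in_Xprod[OF valid_all[of n "w - 1"], of i] n w i step_facts(2)[OF n w] by auto
  then have "conj_at n w i (z n w i) + ereal (x n w \<bullet> (z n (w - 1) i - z n w i)) + ereal 0
      \<le> conj_at n (w - 1) i (z n (w - 1) i)"
    using update_inequality_holds[OF n w i] unfolding update_inequality_def by (simp add: zero_ereal_def[symmetric])
  from descent_slack[OF n w fin i this]
  show "dual_finite n w" "neg_dual n w + (norm (x n w - x n (w - 1)))\<^sup>2 / 2 \<le> neg_dual n (w - 1)" by simp_all
qed

lemma sweep_descent:
  assumes n: "n \<ge> 1" and fin: "dual_finite n 0"
  shows "w \<le> wbar \<Longrightarrow> dual_finite n w \<and> neg_dual n w + (\<Sum>k=1..w. (norm (x n k - x n (k - 1)))\<^sup>2) / 2 \<le> neg_dual n 0"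
proof (induction w)
  case (Suc w)
  then show ?case using descent_step[OF n, of "Suc w"] by (simp add: add_divide_distrib)
qed (use fin in simp)

lemma neg_dual_antimono:
  assumes n: "n \<ge> 1" and fin: "dual_finite n 0"
  shows "v \<le> w \<Longrightarrow> w \<le> wbar \<Longrightarrow> neg_dual n w \<le> neg_dual n v"
proof (induction w rule: dec_induct)
  case (step k)
  have "dual_finite n k" using sweep_descent[OF n fin, of k] step by simp
  then have "neg_dual n (Suc k) + (norm (x n (Suc k) - x n k))\<^sup>2 / 2 \<le> neg_dual n k"
    using descent_step(2)[OF n, of "Suc k"] step by simp
  moreover have "0 \<le> (norm (x n (Suc k) - x n k))\<^sup>2" by simp
  ultimately show ?case using step by linarith
qed simp

text \<open>
  After its last update in a sweep a block keeps its dual vector and its conjugate, so the inequality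
  obtained in that update is still available at the end of the sweep.
\<close>

lemma last_update:
  assumes n: "n \<ge> 1" and a: "\<alpha> \<in> blocks" and upd: "\<exists>w\<in>{1..wbar}. \<alpha> \<in> S n w"
  defines "p \<equiv> last_index wbar S n \<alpha>"
  shows "p \<in> {1..wbar}" "\<alpha> \<in> S n p" "p < w \<Longrightarrow> w \<le> wbar \<Longrightarrow> \<alpha> \<notin> S n w"
    "p \<le> w \<Longrightarrow> w \<le> wbar \<Longrightarrow> z n w \<alpha> = z n p \<alpha> \<and> conj_at n w \<alpha> = conj_at n p \<alpha>"
proof -
  let ?W = "{w. 1 \<le> w \<and> w \<le> wbar \<and> \<alpha> \<in> S n w}"
  have W: "finite ?W" "?W \<noteq> {}" using upd by auto
  have p: "p \<in> ?W" using Max_in[OF W] unfolding p_def last_index_def .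
  then show "p \<in> {1..wbar}" "\<alpha> \<in> S n p" by auto
  have later: "\<alpha> \<notin> S n w" if "p < w" "w \<le> wbar" for w
    using Max_ge[OF W(1), of w] that p unfolding p_def last_index_def by fastforce
  show "p < w \<Longrightarrow> w \<le> wbar \<Longrightarrow> \<alpha> \<notin> S n w" by (rule later)
  show "p \<le> w \<Longrightarrow> w \<le> wbar \<Longrightarrow> z n w \<alpha> = z n p \<alpha> \<and> conj_at n w \<alpha> = conj_at n p \<alpha>"
  proof (induction w rule: dec_induct)
    case (step k)
    then show ?case using unchanged_block[OF n _ a later, of "Suc k"] p by simp
  qed simp
qed

text \<open>
  Conjugates of node functions can be infinite initially, but an update makes them finite, and every node
  is updated in every sweep.
\<close>

lemma dual_finite_end:
  assumes n: "n \<ge> 1"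
  shows "dual_finite n wbar"
  unfolding dual_finite_def
proof
  fix \<alpha> assume a: "\<alpha> \<in> blocks"
  show "conj_at n wbar \<alpha> (z n wbar \<alpha>) \<noteq> \<infinity>"
  proof (cases "\<alpha> \<in> edges P")
    case True
    then have "z n wbar \<alpha> \<in> perp P (hyper P \<alpha>)" using valid_all[OF n, of wbar] unfolding valid_def by blast
    then show ?thesis using conj_at_edge_perp[OF True] by simp
  next
    case False
    then have "\<exists>w\<in>{1..wbar}. \<alpha> \<in> S n w" using a cover[OF n] by blast
    note lu = last_update[OF n a this]
    show ?thesis using update_inequality_holds[OF n lu(1,2)] lu(4)[of wbar] lu(1) unfolding update_inequality_def by auto
  qed
qed

lemma conj_at_carry_value:
  assumes n: "n \<ge> 1" and a: "\<alpha> \<in> blocks"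
  shows "conj_at (n + 1) 0 \<alpha> (z (n + 1) 0 \<alpha>) = conj_at n wbar \<alpha> (z n wbar \<alpha>)"
proof (cases "\<alpha> \<in> edges P")
  case True
  have "z n wbar \<alpha> \<in> perp P (hyper P \<alpha>)" "z (n + 1) 0 \<alpha> \<in> perp P (hyper P \<alpha>)"
    using valid_all[OF n, of wbar] valid_all[of "n + 1" 0] True unfolding valid_def by auto
  then show ?thesis using conj_at_edge_perp[OF True] by simp
qed (use a conj_at_carry[OF n] carry_facts(1)[OF n] in simp)

lemma dual_finite_carry: "n \<ge> 1 \<Longrightarrow> dual_finite (n + 1) 0"
  using dual_finite_end conj_at_carry_value unfolding dual_finite_def by simp

lemma neg_dual_carry: "n \<ge> 1 \<Longrightarrow> neg_dual (n + 1) 0 = neg_dual n wbar"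
  unfolding neg_dual_def conj_val_def using conj_at_carry_value x_carry by simp

lemma x_travel:
  "p \<le> w \<Longrightarrow> norm (x n p - x n w) \<le> (\<Sum>k\<in>{p<..w}. norm (x n k - x n (k - 1)))"
proof (induction w rule: dec_induct)
  case (step k)
  have "norm (x n p - x n (Suc k)) \<le> norm (x n p - x n k) + norm (x n (Suc k) - x n k)"
    using norm_triangle_ineq4[of "x n p - x n k" "x n (Suc k) - x n k"] by simp
  moreover have "{p<..Suc k} = insert (Suc k) {p<..k}" using step by auto
  ultimately show ?case using step by simp
qed simp

definition travel :: "nat \<Rightarrow> real" where
  "travel n = (\<Sum>k=1..wbar. norm (x n k - x n (k - 1)))"

lemma x_travel_le:
  assumes "p \<le> wbar"
  shows "norm (x n p - x n wbar) \<le> travel n"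
proof -
  have "norm (x n p - x n wbar) \<le> (\<Sum>k\<in>{p<..wbar}. norm (x n k - x n (k - 1)))" by (rule x_travel[OF assms])
  also have "\<dots> \<le> travel n" unfolding travel_def by (rule sum_mono2) auto
  finally show ?thesis .
qed

lemma travel_le:
  assumes n: "n \<ge> 1" and fin: "dual_finite n 0"
  shows "travel n \<le> sqrt (real wbar) * sqrt (2 * (neg_dual n 0 - neg_dual n wbar))"
proof -
  have "(travel n)\<^sup>2 \<le> (\<Sum>k=1..wbar. (norm (x n k - x n (k - 1)))\<^sup>2) * real wbar"
    unfolding travel_def using sum_squared_le_sum_of_squares[of "\<lambda>k. norm (x n k - x n (k - 1))" "{1..wbar}"] by simp
  also have "\<dots> \<le> (2 * (neg_dual n 0 - neg_dual n wbar)) * real wbar"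
    using sweep_descent[OF n fin, of wbar] by (intro mult_right_mono) auto
  finally have "travel n \<le> sqrt ((2 * (neg_dual n 0 - neg_dual n wbar)) * real wbar)" by (rule real_le_rsqrt)
  then show ?thesis by (simp add: real_sqrt_mult mult_ac)
qed

section \<open>Comparison with a dual maximizer\<close>

definition conj_star :: "'k \<Rightarrow> 'a ^ 'k \<Rightarrow> ereal" where
  "conj_star \<alpha> u = conjugate (Xprod P) (bf P \<alpha>) u"

definition conj_star_val :: "'k \<Rightarrow> real" where
  "conj_star_val \<alpha> = real_of_ereal (conj_star \<alpha> (zstar \<alpha>))"

definition xstar :: "'a ^ 'k" where
  "xstar = xbar P - (\<Sum>\<alpha>\<in>blocks. zstar \<alpha>)"

definition dual_max :: real where
  "dual_max = - (norm xstar)\<^sup>2 / 2 + (norm (xbar P))\<^sup>2 / 2 - (\<Sum>\<alpha>\<in>blocks. conj_star_val \<alpha>)"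

lemma conj_star_le:
  assumes v: "valid n w" and \<alpha>: "\<alpha> \<in> blocks"
  shows "conj_star \<alpha> u \<le> conj_at n w \<alpha> u"
  unfolding conj_star_def conj_at_def
proof (rule conjugate_antimono)
  fix y assume y: "y \<in> Xprod P"
  show "bfn P g n w \<alpha> y \<le> bf P \<alpha> y"
  proof (cases "\<alpha> \<in> nodes4 P")
    case True
    then have N: "\<alpha> \<in> nodes P" using nodes4_subset by blast
    then show ?thesis using v True Xprod_coord[OF y N] by (simp add: bfn_nodes4 bf_node valid_def)
  qed (simp add: bfn_other)
qed

lemma conj_at_eq_conj_star: "\<alpha> \<notin> nodes4 P \<Longrightarrow> conj_at n w \<alpha> u = conj_star \<alpha> u"
  by (simp add: conj_at_def conj_star_def bfn_other)

lemma conj_star_not_MInf: "\<alpha> \<in> blocks \<Longrightarrow> conj_star \<alpha> u \<noteq> -\<infinity>"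
  using feasible_point conjugate_not_MInf unfolding conj_star_def by blast

lemma zstar_in: "\<alpha> \<in> blocks \<Longrightarrow> zstar \<alpha> \<in> Xprod P"
  using optimizer unfolding dual_optimizer_def by blast

text \<open>
  Replacing node functions by minorants raises the conjugates and so lowers the dual function.
\<close>

lemma dualn_le_dual_zstar:
  assumes "n \<ge> 1" "w \<le> wbar"
  shows "dualn P g n w (z n w) \<le> dual P zstar"
proof -
  note v = valid_all[OF assms]
  have "(\<Sum>\<alpha>\<in>blocks. conj_star \<alpha> (z n w \<alpha>)) \<le> (\<Sum>\<alpha>\<in>blocks. conj_at n w \<alpha> (z n w \<alpha>))"
    by (rule sum_mono) (rule conj_star_le[OF v])
  then have "dualn P g n w (z n w) \<le> dual P (z n w)"
    unfolding dual_of_def conj_star_def conj_at_def by (intro ereal_minus_mono) auto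
  also have "\<dots> \<le> dual P zstar"
    using optimizer valid_in_Xprod[OF v] unfolding dual_optimizer_def by blast
  finally show ?thesis .
qed

text \<open>
  The dual value at the end of the first sweep is finite and does not exceed the maximal one, so none of
  the conjugates in the latter can be infinite.
\<close>

lemma conj_star_zstar_finite:
  assumes "\<alpha> \<in> blocks"
  shows "conj_star \<alpha> (zstar \<alpha>) = ereal (conj_star_val \<alpha>)"
proof -
  have "dualn P g 1 wbar (z 1 wbar) = ereal (- neg_dual 1 wbar)"
    using dualn_fin[OF dual_finite_end[of 1]] by (metis ereal_uminus_uminus order_refl uminus_ereal.simps(1))
  then have "dual P zstar \<noteq> -\<infinity>" using dualn_le_dual_zstar[of 1 wbar] by auto
  then have "(\<Sum>\<alpha>\<in>blocks. conj_star \<alpha> (zstar \<alpha>)) \<noteq> \<infinity>"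
    unfolding dual_of_def conj_star_def[symmetric] by auto
  then have "conj_star \<alpha> (zstar \<alpha>) \<noteq> \<infinity>" using assms by (auto simp: sum_Pinfty)
  then show ?thesis using conj_star_not_MInf[OF assms, of "zstar \<alpha>"]
    unfolding conj_star_val_def by (cases "conj_star \<alpha> (zstar \<alpha>)") auto
qed

lemma dual_zstar: "dual P zstar = ereal dual_max"
proof -
  have "(\<Sum>\<alpha>\<in>blocks. conj_star \<alpha> (zstar \<alpha>)) = ereal (\<Sum>\<alpha>\<in>blocks. conj_star_val \<alpha>)"
    using conj_star_zstar_finite by simp
  then show ?thesis
    unfolding dual_of_def conj_star_def[symmetric] xstar_def[symmetric] by (simp add: dual_max_def)
qed

lemma neg_dual_ge_optimum: "n \<ge> 1 \<Longrightarrow> w \<le> wbar \<Longrightarrow> dual_finite n w \<Longrightarrow> 0 \<le> neg_dual n w + dual_max"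
  using dualn_le_dual_zstar[of n w] dualn_fin[of n w] unfolding dual_zstar
  by (cases "dualn P g n w (z n w)") auto

lemma zstar_edge:
  assumes "\<alpha> \<in> edges P"
  shows "zstar \<alpha> \<in> perp P (hyper P \<alpha>)" "conj_star_val \<alpha> = 0"
proof -
  have a: "\<alpha> \<in> blocks" "\<alpha> \<notin> nodes4 P" using assms nodes_edges_disjoint nodes4_subset by auto
  have eq: "conj_at 1 0 \<alpha> (zstar \<alpha>) = ereal (conj_star_val \<alpha>)"
    using conj_star_zstar_finite[OF a(1)] conj_at_eq_conj_star[OF a(2)] by simp
  show p: "zstar \<alpha> \<in> perp P (hyper P \<alpha>)"
    by (rule perp_of_conj_at[OF assms zstar_in[OF a(1)], of 1 0]) (unfold eq, simp)
  show "conj_star_val \<alpha> = 0" using conj_at_edge_perp[OF assms p, of 1 0] eq by simp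
qed

text \<open>
  Edges outside \<open>En n\<close> carry zero dual vectors during sweep \<open>n\<close>.  To compare block by block, the edge
  part of the maximizer is rewritten over \<open>En n\<close>, which leaves the dual value unchanged because the
  conjugates of the edge functions vanish on the orthogonal complements.  The regularity constant keeps
  the new vectors bounded independently of \<open>n\<close>.
\<close>

lemma zstar_redistributed:
  "\<exists>B. \<forall>n\<ge>1. \<exists>y. (\<forall>\<alpha>\<in>blocks. norm (y \<alpha>) \<le> B) \<and> (\<forall>i\<in>nodes P. y i = zstar i)
     \<and> (\<forall>\<alpha>\<in>edges P. y \<alpha> \<in> perp P (hyper P \<alpha>)) \<and> (\<forall>\<alpha>\<in>edges P - En n. y \<alpha> = 0)
     \<and> (\<Sum>\<alpha>\<in>blocks. y \<alpha>) = (\<Sum>\<alpha>\<in>blocks. zstar \<alpha>)"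
proof -
  define v where "v = (\<Sum>\<alpha>\<in>edges P. zstar \<alpha>)"
  define B where "B = (\<Sum>i\<in>nodes P. norm (zstar i)) + Creg * norm v"
  have C0: "Creg > 0" using Creg unfolding regularity_const_def by blast
  have v: "v \<in> perp P (Dspace P)"
  proof -
    have "v \<in> Xprod P" unfolding v_def using zstar_in by (intro subspace_sum[OF Xprod_subspace]) auto
    moreover have "v \<bullet> y = 0" if "y \<in> Dspace P" for y
      unfolding v_def inner_sum_left
      by (rule sum.neutral) (use zstar_edge(1) that in \<open>auto simp: perp_iff Hcap_def\<close>)
    ultimately show ?thesis by (simp add: perp_iff)
  qed
  have "\<exists>y. (\<forall>\<alpha>\<in>blocks. norm (y \<alpha>) \<le> B) \<and> (\<forall>i\<in>nodes P. y i = zstar i)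
     \<and> (\<forall>\<alpha>\<in>edges P. y \<alpha> \<in> perp P (hyper P \<alpha>)) \<and> (\<forall>\<alpha>\<in>edges P - En n. y \<alpha> = 0)
     \<and> (\<Sum>\<alpha>\<in>blocks. y \<alpha>) = (\<Sum>\<alpha>\<in>blocks. zstar \<alpha>)" if n: "n \<ge> 1" for n
  proof -
    have cn: "connects P (En n)" by (rule edge_facts(1)[OF n])
    then have En: "En n \<subseteq> edges P" unfolding connects_def by blast
    obtain u where u: "v = (\<Sum>\<alpha>\<in>En n. u \<alpha>)"
      "\<forall>\<alpha>\<in>En n. u \<alpha> \<in> perp P (hyper P \<alpha>) \<and> norm (u \<alpha>) \<le> Creg * norm v"
      using Creg v cn unfolding regularity_const_def by blast
    define y where "y \<alpha> = (if \<alpha> \<in> nodes P then zstar \<alpha> else if \<alpha> \<in> En n then u \<alpha> else 0)" for \<alpha>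
    have yE: "y \<alpha> = (if \<alpha> \<in> En n then u \<alpha> else 0)" if "\<alpha> \<in> edges P" for \<alpha>
      using that nodes_edges_disjoint unfolding y_def by auto
    have b0: "0 \<le> (\<Sum>i\<in>nodes P. norm (zstar i))" "0 \<le> Creg * norm v" using C0 by (auto intro: sum_nonneg)
    have "norm (y \<alpha>) \<le> B" if a: "\<alpha> \<in> blocks" for \<alpha>
    proof (cases "\<alpha> \<in> nodes P")
      case True
      then have "norm (zstar \<alpha>) \<le> (\<Sum>i\<in>nodes P. norm (zstar i))" by (intro member_le_sum) auto
      then show ?thesis using True b0 unfolding B_def y_def by simp
    next
      case False
      then have "norm (y \<alpha>) \<le> Creg * norm v" using u(2) b0 unfolding y_def by simp
      then show ?thesis using b0 unfolding B_def by simp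
    qed
    moreover have "y \<alpha> \<in> perp P (hyper P \<alpha>)" if "\<alpha> \<in> edges P" for \<alpha>
      using u(2) yE[OF that] subspace_0[OF Xprod_subspace] by (auto simp: perp_iff)
    moreover have "(\<Sum>\<alpha>\<in>blocks. y \<alpha>) = (\<Sum>\<alpha>\<in>blocks. zstar \<alpha>)"
    proof -
      have "(\<Sum>\<alpha>\<in>edges P. y \<alpha>) = (\<Sum>\<alpha>\<in>En n. y \<alpha>)"
        by (rule sum.mono_neutral_right) (use En yE in auto)
      also have "\<dots> = v" unfolding u(1) by (rule sum.cong) (use En yE in auto)
      finally have "(\<Sum>\<alpha>\<in>edges P. y \<alpha>) = (\<Sum>\<alpha>\<in>edges P. zstar \<alpha>)" by (simp add: v_def)
      moreover have "(\<Sum>\<alpha>\<in>nodes P. y \<alpha>) = (\<Sum>\<alpha>\<in>nodes P. zstar \<alpha>)" by (simp add: y_def)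
      moreover have "edges P \<inter> nodes P = {}" using nodes_edges_disjoint by blast
      ultimately show ?thesis by (simp add: sum.union_disjoint)
    qed
    moreover have "\<forall>i\<in>nodes P. y i = zstar i" by (simp add: y_def)
    moreover have "\<forall>\<alpha>\<in>edges P - En n. y \<alpha> = 0" using yE by simp
    ultimately show ?thesis by blast
  qed
  then show ?thesis by blast
qed

lemma iterates_bound: "\<exists>B. \<forall>n\<ge>1. \<forall>\<alpha>\<in>blocks. norm (z n wbar \<alpha>) \<le> B"
proof -
  obtain B where B: "\<forall>v\<in>{z n w \<alpha> | n w \<alpha>. n \<ge> 1 \<and> w \<in> {1..wbar} \<and> \<alpha> \<in> nodes P \<union> edges P}. norm v \<le> B"
    using iterates_bounded unfolding bounded_iff by blast
  have "norm (z n wbar \<alpha>) \<le> B" if "n \<ge> 1" "\<alpha> \<in> blocks" for n \<alpha>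
  proof -
    have "wbar \<in> {1..wbar}" using wbar by simp
    then show ?thesis using B that by blast
  qed
  then show ?thesis by blast
qed

text \<open>
  In the last update \<open>p\<close> of node \<open>i\<close>, \<open>x\<close> became a subgradient of the conjugate at the dual vector;
  evaluating this at a subgradient of the minorant at \<open>x n p $ i\<close> yields the Fenchel-Young inequality
  in the reverse direction.  By \<open>assumption_A2\<close> the coordinate \<open>i\<close> of \<open>x\<close> does not move afterwards.
\<close>

lemma contact_at_end:
  assumes n: "n \<ge> 1" and i: "i \<in> nodes4 P"
  shows "conj_at n wbar i (z n wbar i) \<le> ereal (z n wbar i \<bullet> x n wbar - g n wbar i (x n wbar $ i))"
proof -
  have iN: "i \<in> nodes P" using i nodes4_subset by blast
  have ib: "i \<in> blocks" using iN by blast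
  have "\<exists>w\<in>{1..wbar}. i \<in> S n w" using cover[OF n] iN by blast
  note lu = last_update[OF n ib this]
  define p where "p = last_index wbar S n i"
  note lu = lu[folded p_def]
  have pw: "p \<le> wbar" using lu(1) by simp
  have geq: "p \<le> w \<Longrightarrow> w \<le> wbar \<Longrightarrow> y \<in> node_space P i \<Longrightarrow> g n w i y = g n p i y" for w y
  proof (induction w rule: dec_induct)
    case (step k)
    then show ?case using step_facts(5)[OF n, of "Suc k" i y] i lu(3)[of "Suc k"] by simp
  qed simp
  have vH: "p \<le> w \<Longrightarrow> w \<le> wbar \<Longrightarrow> vH P z n w $ i = vH P z n p $ i" for w
  proof (induction w rule: dec_induct)
    case (step k)
    have "z n (Suc k) \<alpha> $ i = z n k \<alpha> $ i" if a: "\<alpha> \<in> edges P" for \<alpha>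
    proof (cases "\<alpha> \<in> S n (Suc k)")
      case True
      have "z n w \<alpha> \<in> perp P (hyper P \<alpha>)" if "w \<le> wbar" for w
        using valid_all[OF n that] a unfolding valid_def by blast
      then have "z n (Suc k) \<alpha> - z n k \<alpha> \<in> perp P (hyper P \<alpha>)"
        using step by (simp add: perp_iff subspace_diff[OF Xprod_subspace] inner_diff_left)
      moreover have "Suc k \<in> {last_index wbar S n i + 1..wbar}" using step unfolding p_def by simp
      ultimately have "(z n (Suc k) \<alpha> - z n k \<alpha>) $ i = 0"
        using A2 n i True a unfolding assumption_A2_def by blast
      then show ?thesis by simp
    next
      case False
      then show ?thesis using unchanged_block(1)[OF n, of "Suc k" \<alpha>] a step by simp
    qed
    then have "vH P z n (Suc k) $ i = vH P z n k $ i" unfolding vH_def by (simp add: sum_component)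
    then show ?case using step by simp
  qed simp
  have vp: "valid n p" using valid_all[OF n pw] .
  have vw: "valid n wbar" using valid_all[OF n] by simp
  have zeq: "z n wbar i = z n p i" "conj_at n wbar i = conj_at n p i" using lu(4)[of wbar] pw by auto
  have xeq: "x n wbar $ i = x n p $ i"
    using x_coord[OF vp iN] x_coord[OF vw iN] vH[of wbar] pw zeq by simp
  have xX: "x n p $ i \<in> node_space P i" using Xprod_coord[OF x_in_Xprod[OF vp] iN] .
  have zx: "z n p i \<bullet> v = z n p i $ i \<bullet> v $ i" for v
    by (rule inner_supported) (use vp iN in \<open>auto simp: valid_def\<close>)
  have "convex_on (node_space P i) (g n p i)" using vp i unfolding valid_def by blast
  from convex_on_subspace_subgradient[OF node_subspace[OF iN] this xX]
  obtain s where s: "s \<in> node_space P i" "\<And>y. y \<in> node_space P i \<Longrightarrow> g n p i (x n p $ i) + s \<bullet> (y - x n p $ i) \<le> g n p i y"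
    by blast
  have "conj_at n p i (axis i s) \<le> ereal (s \<bullet> x n p $ i - g n p i (x n p $ i))"
    unfolding conj_at_def bfn_nodes4[OF i]
    by (rule conjugate_axis_le[OF iN, of _ _ "\<lambda>t. ereal (g n p i t)"])
      (use s(2) in \<open>auto simp: inner_diff_right algebra_simps\<close>)
  moreover have "conj_at n p i (z n p i) + ereal (x n p \<bullet> (axis i s - z n p i)) \<le> conj_at n p i (axis i s)"
    using update_inequality_holds[OF n lu(1,2)] axis_in_Xprod[OF data iN s(1)] unfolding update_inequality_def by blast
  ultimately have "conj_at n p i (z n p i) + ereal (x n p \<bullet> (axis i s - z n p i))
    \<le> ereal (s \<bullet> x n p $ i - g n p i (x n p $ i))" by (rule order_trans[rotated])
  then have "conj_at n p i (z n p i) \<le> ereal (z n p i \<bullet> x n p - g n p i (x n p $ i))"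
    by (cases "conj_at n p i (z n p i)")
      (auto simp: inner_diff_right inner_axis inner_commute[of "x n p"] inner_commute[of s] inner_axis')
  moreover have "g n wbar i (x n p $ i) = g n p i (x n p $ i)" using geq[OF pw order_refl xX] .
  moreover have "z n p i \<bullet> x n wbar = z n p i \<bullet> x n p" using xeq by (simp add: zx)
  ultimately show ?thesis unfolding zeq xeq by simp
qed

definition minorant_gap :: "nat \<Rightarrow> 'k \<Rightarrow> real" where
  "minorant_gap n i = real_of_ereal (nodefun P i (x n wbar $ i)) - g n wbar i (x n wbar $ i)"

lemma edge_idle:
  assumes n: "n \<ge> 1" and a: "\<alpha> \<in> edges P" "\<alpha> \<notin> En n"
  shows "w \<le> wbar \<Longrightarrow> z n w \<alpha> = 0"
proof (induction w)
  case (Suc w)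
  have "\<alpha> \<notin> S n (Suc w)" using a En_eq[OF n] Suc by auto
  then show ?case using unchanged_block(1)[OF n, of "Suc w" \<alpha>] a Suc by simp
qed (use edge_facts(2)[OF n a] in simp)

text \<open>
  For a block that is not in \<open>nodes4\<close>, the inequality of its last update is evaluated at the
  redistributed maximizer; replacing the iterate of that update by the final one costs at most
  \<open>B * travel n\<close>.  For a node in \<open>nodes4\<close>, the conjugate of \<open>nodefun P i\<close> is bounded below by
  testing with the final iterate, and \<open>contact_at_end\<close> turns this into the same inequality up to
  \<open>minorant_gap n i\<close>.
\<close>

lemma comparison_with_optimizer:
  "\<exists>M>0. \<forall>n\<ge>1. neg_dual n wbar + dual_max \<le> M * travel n + (\<Sum>i\<in>nodes4 P. minorant_gap n i)"
proof -
  obtain B1 where B1: "\<forall>n\<ge>1. \<exists>y. (\<forall>\<alpha>\<in>blocks. norm (y \<alpha>) \<le> B1) \<and> (\<forall>i\<in>nodes P. y i = zstar i)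
     \<and> (\<forall>\<alpha>\<in>edges P. y \<alpha> \<in> perp P (hyper P \<alpha>)) \<and> (\<forall>\<alpha>\<in>edges P - En n. y \<alpha> = 0)
     \<and> (\<Sum>\<alpha>\<in>blocks. y \<alpha>) = (\<Sum>\<alpha>\<in>blocks. zstar \<alpha>)" using zstar_redistributed by blast
  obtain B2 where B2: "\<forall>n\<ge>1. \<forall>\<alpha>\<in>blocks. norm (z n wbar \<alpha>) \<le> B2" using iterates_bound by blast
  define B where "B = max 0 (B1 + B2)"
  define M where "M = real (card blocks) * B + 1"
  have B0: "B \<ge> 0" by (simp add: B_def)
  have "neg_dual n wbar + dual_max \<le> M * travel n + (\<Sum>i\<in>nodes4 P. minorant_gap n i)" if n: "n \<ge> 1" for n
  proof -
    obtain y where y: "\<forall>\<alpha>\<in>blocks. norm (y \<alpha>) \<le> B1" "\<forall>i\<in>nodes P. y i = zstar i"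
      "\<forall>\<alpha>\<in>edges P. y \<alpha> \<in> perp P (hyper P \<alpha>)" "\<forall>\<alpha>\<in>edges P - En n. y \<alpha> = 0"
      "(\<Sum>\<alpha>\<in>blocks. y \<alpha>) = (\<Sum>\<alpha>\<in>blocks. zstar \<alpha>)" using B1 n by blast
    have T0: "0 \<le> travel n" unfolding travel_def by (intro sum_nonneg) auto
    have vw: "valid n wbar" using valid_all[OF n] by simp
    have yX: "y \<alpha> \<in> Xprod P" if "\<alpha> \<in> blocks" for \<alpha>
      using that y(2,3) zstar_in by (auto simp: perp_iff)
    have dist: "norm (y \<alpha> - z n wbar \<alpha>) \<le> B" if a: "\<alpha> \<in> blocks" for \<alpha>
    proof -
      have "norm (y \<alpha> - z n wbar \<alpha>) \<le> norm (y \<alpha>) + norm (z n wbar \<alpha>)" by (rule norm_triangle_ineq4)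
      also have "\<dots> \<le> B1 + B2" using y(1) B2 n a by (intro add_mono) auto
      finally show ?thesis by (simp add: B_def)
    qed
    have cy: "conj_star \<alpha> (y \<alpha>) = ereal (conj_star_val \<alpha>)" if a: "\<alpha> \<in> blocks" for \<alpha>
    proof (cases "\<alpha> \<in> nodes P")
      case False
      then have e: "\<alpha> \<in> edges P" "\<alpha> \<notin> nodes4 P" using a nodes4_subset by auto
      then show ?thesis
        using conj_at_edge_perp[OF e(1), of "y \<alpha>" 1 0] y(3) zstar_edge(2)[OF e(1)]
          conj_at_eq_conj_star[OF e(2)] by (simp add: zero_ereal_def)
    qed (use y(2) conj_star_zstar_finite[OF a] in simp)
    have each: "conj_val n wbar \<alpha> + x n wbar \<bullet> (y \<alpha> - z n wbar \<alpha>) - B * travel n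
        - (if \<alpha> \<in> nodes4 P then minorant_gap n \<alpha> else 0) \<le> conj_star_val \<alpha>" if a: "\<alpha> \<in> blocks" for \<alpha>
    proof -
      have cv: "conj_at n wbar \<alpha> (z n wbar \<alpha>) = ereal (conj_val n wbar \<alpha>)"
        by (rule conj_at_conj_val[OF dual_finite_end[OF n] a])
      have BT: "0 \<le> B * travel n" using B0 T0 by simp
      consider "\<alpha> \<in> edges P" "\<alpha> \<notin> En n" | "\<alpha> \<in> nodes4 P" | "\<alpha> \<notin> nodes4 P" "\<alpha> \<in> En n \<or> \<alpha> \<in> nodes P"
        using a nodes4_subset by blast
      then show ?thesis
      proof cases
        case 1
        then have "y \<alpha> = 0" "z n wbar \<alpha> = 0" "\<alpha> \<notin> nodes4 P"
          using y(4) edge_idle[OF n 1] nodes4_subset nodes_edges_disjoint by auto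
        moreover have "conj_val n wbar \<alpha> = 0"
          using conj_at_edge[OF 1(1), of n wbar 0] \<open>z n wbar \<alpha> = 0\<close> by (simp add: conj_val_def)
        ultimately show ?thesis using zstar_edge(2)[OF 1(1)] BT by simp
      next
        case 2
        then have N: "\<alpha> \<in> nodes P" using nodes4_subset by blast
        let ?q = "x n wbar $ \<alpha>"
        have xX: "x n wbar \<in> Xprod P" by (rule x_in_Xprod[OF vw])
        have "ereal (y \<alpha> \<bullet> x n wbar) - nodefun P \<alpha> ?q \<le> ereal (conj_star_val \<alpha>)"
          using conjugate_ge[OF xX, of "y \<alpha>" "bf P \<alpha>"] cy[OF a] by (simp add: conj_star_def bf_node[OF N])
        then have "y \<alpha> \<bullet> x n wbar - real_of_ereal (nodefun P \<alpha> ?q) \<le> conj_star_val \<alpha>"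
          by (subst (asm) nodefun4_finite[OF 2 Xprod_coord[OF xX N]]) simp
        moreover have "conj_val n wbar \<alpha> \<le> z n wbar \<alpha> \<bullet> x n wbar - g n wbar \<alpha> ?q"
          using contact_at_end[OF n 2] cv by simp
        ultimately show ?thesis using 2 BT
          by (simp add: minorant_gap_def inner_diff_right inner_commute)
      next
        case 3
        have "\<exists>w\<in>{1..wbar}. \<alpha> \<in> S n w" using 3(2) En_eq[OF n] cover[OF n] by blast
        note lu = last_update[OF n a this]
        define p where "p = last_index wbar S n \<alpha>"
        note lu = lu[folded p_def]
        have pw: "p \<le> wbar" using lu(1) by simp
        have zeq: "z n wbar \<alpha> = z n p \<alpha>" "conj_at n wbar \<alpha> = conj_at n p \<alpha>" using lu(4)[of wbar] pw by auto
        have "conj_at n p \<alpha> (z n p \<alpha>) + ereal (x n p \<bullet> (y \<alpha> - z n p \<alpha>)) \<le> conj_at n p \<alpha> (y \<alpha>)"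
          using update_inequality_holds[OF n lu(1,2)] yX[OF a] unfolding update_inequality_def by blast
        then have "conj_val n wbar \<alpha> + x n p \<bullet> (y \<alpha> - z n wbar \<alpha>) \<le> conj_star_val \<alpha>"
          using cv zeq cy[OF a] conj_at_eq_conj_star[OF 3(1)] by simp
        moreover have "(x n wbar - x n p) \<bullet> (y \<alpha> - z n wbar \<alpha>) \<le> travel n * B"
        proof -
          have "(x n wbar - x n p) \<bullet> (y \<alpha> - z n wbar \<alpha>) \<le> norm (x n wbar - x n p) * norm (y \<alpha> - z n wbar \<alpha>)"
            by (rule norm_cauchy_schwarz)
          also have "\<dots> \<le> travel n * B"
            using x_travel_le[OF pw, of n] dist[OF a] T0 by (intro mult_mono) (auto simp: norm_minus_commute)
          finally show ?thesis .
        qed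
        ultimately show ?thesis using 3(1) by (simp add: inner_diff_left mult.commute)
      qed
    qed
    have "(\<Sum>\<alpha>\<in>blocks. conj_val n wbar \<alpha> + x n wbar \<bullet> (y \<alpha> - z n wbar \<alpha>) - B * travel n
        - (if \<alpha> \<in> nodes4 P then minorant_gap n \<alpha> else 0)) \<le> (\<Sum>\<alpha>\<in>blocks. conj_star_val \<alpha>)"
      by (rule sum_mono) (rule each)
    moreover have "(\<Sum>\<alpha>\<in>blocks. if \<alpha> \<in> nodes4 P then minorant_gap n \<alpha> else 0) = (\<Sum>i\<in>nodes4 P. minorant_gap n i)"
      by (rule sum.mono_neutral_cong_right) (use nodes4_subset in auto)
    moreover have "(\<Sum>\<alpha>\<in>blocks. x n wbar \<bullet> (y \<alpha> - z n wbar \<alpha>)) = x n wbar \<bullet> (x n wbar - xstar)"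
      by (simp add: x_def xstar_def inner_sum_right[symmetric] sum_subtractf y(5))
    ultimately have "(\<Sum>\<alpha>\<in>blocks. conj_val n wbar \<alpha>) + x n wbar \<bullet> (x n wbar - xstar)
        - real (card blocks) * (B * travel n) - (\<Sum>i\<in>nodes4 P. minorant_gap n i) \<le> (\<Sum>\<alpha>\<in>blocks. conj_star_val \<alpha>)"
      by (simp add: sum.distrib sum_subtractf)
    moreover have "(norm (x n wbar - xstar))\<^sup>2 = 2 * (x n wbar \<bullet> (x n wbar - xstar)) - (norm (x n wbar))\<^sup>2 + (norm xstar)\<^sup>2"
      unfolding power2_norm_eq_inner by (simp add: inner_diff_left inner_diff_right inner_commute)
    moreover have "0 \<le> (norm (x n wbar - xstar))\<^sup>2" by simp
    moreover have "M * travel n = real (card blocks) * (B * travel n) + travel n"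
      by (simp add: M_def algebra_simps)
    ultimately show ?thesis using T0 unfolding neg_dual_def dual_max_def by argo
  qed
  moreover have "M > 0" using B0 unfolding M_def by (simp add: add_nonneg_pos)
  ultimately show ?thesis by blast
qed

section \<open>The error of the affine minorants\<close>

lemma x_end_bounded: "\<exists>R. \<forall>n\<ge>1. norm (x n wbar) \<le> R"
proof -
  obtain B where B: "\<forall>n\<ge>1. \<forall>\<alpha>\<in>blocks. norm (z n wbar \<alpha>) \<le> B" using iterates_bound by blast
  have "norm (x n wbar) \<le> norm (xbar P) + (\<Sum>\<alpha>\<in>blocks. B)" if n: "n \<ge> 1" for n
  proof -
    have "norm (\<Sum>\<alpha>\<in>blocks. z n wbar \<alpha>) \<le> (\<Sum>\<alpha>\<in>blocks. B)"
      by (rule order_trans[OF norm_sum sum_mono]) (use B n in blast)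
    then show ?thesis unfolding x_def using norm_triangle_ineq4[of "xbar P"] by (meson add_left_mono order_trans)
  qed
  then show ?thesis by blast
qed

text \<open>
  By \<open>assumption_A3\<close> the next sweep starts with a subgradient update at the point \<open>x n wbar $ i\<close>, whose slack
  contains \<open>minorant_gap n i\<close>.  The slope \<open>s\<close> stays bounded because finite convex functions have
  bounded subgradients on bounded sets.
\<close>

lemma minorant_gap_le_descent:
  "\<exists>L\<ge>0. \<forall>n\<ge>1. \<forall>i\<in>nodes4 P.
     minorant_gap n i \<le> (neg_dual (n + 1) 0 - neg_dual (n + 1) 1) + L * norm (x (n + 1) 1 - x (n + 1) 0)"
proof -
  obtain R where R: "\<forall>n\<ge>1. norm (x n wbar) \<le> R" using x_end_bounded by blast
  obtain B where B: "\<forall>n\<ge>1. \<forall>\<alpha>\<in>blocks. norm (z n wbar \<alpha>) \<le> B" using iterates_bound by blast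
  have "\<exists>L. \<forall>q\<in>node_space P i. \<forall>s\<in>subdifferential (node_space P i) (nodefun P i) q. norm q \<le> R \<longrightarrow> norm s \<le> L"
    if i: "i \<in> nodes4 P" for i
  proof -
    have N: "i \<in> nodes P" using i nodes4_subset by blast
    let ?\<phi> = "\<lambda>y. real_of_ereal (nodefun P i y)"
    have "convex_on (node_space P i) ?\<phi>"
      using closed_convex_fun_finite_imp_convex_on[OF nodefun_closed[OF N] _ subspace_imp_convex[OF node_subspace[OF N]]]
        problem_dataD(5)[OF data] i by blast
    from subgradients_bounded[OF node_subspace[OF N] this, of R] obtain L where
      L: "\<forall>q\<in>node_space P i. \<forall>s\<in>node_space P i. norm q \<le> R \<longrightarrow>
        (\<forall>y\<in>node_space P i. ?\<phi> q + s \<bullet> (y - q) \<le> ?\<phi> y) \<longrightarrow> norm s \<le> L" by blast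
    have "norm s \<le> L" if q: "q \<in> node_space P i" "norm q \<le> R"
      and s: "s \<in> subdifferential (node_space P i) (nodefun P i) q" for q s
    proof -
      have "?\<phi> q + s \<bullet> (y - q) \<le> ?\<phi> y" if y: "y \<in> node_space P i" for y
      proof -
        have "nodefun P i q + ereal (s \<bullet> (y - q)) \<le> nodefun P i y"
          using s y unfolding subdifferential_def by blast
        then show ?thesis
          by (subst (asm) nodefun4_finite[OF i q(1)], subst (asm) nodefun4_finite[OF i y]) simp
      qed
      moreover have "s \<in> node_space P i" using s unfolding subdifferential_def by blast
      ultimately show ?thesis using L q by blast
    qed
    then show ?thesis by blast
  qed
  then obtain L where L: "\<And>i q s. i \<in> nodes4 P \<Longrightarrow> q \<in> node_space P i \<Longrightarrow>
      s \<in> subdifferential (node_space P i) (nodefun P i) q \<Longrightarrow> norm q \<le> R \<Longrightarrow> norm s \<le> L i"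
    by metis
  define L' where "L' = (\<Sum>i\<in>nodes4 P. \<bar>L i\<bar>) + \<bar>B\<bar>"
  have L'0: "L' \<ge> 0" unfolding L'_def by (intro add_nonneg_nonneg sum_nonneg) auto
  have "minorant_gap n i \<le> (neg_dual (n + 1) 0 - neg_dual (n + 1) 1) + L' * norm (x (n + 1) 1 - x (n + 1) 0)"
    if n: "n \<ge> 1" and i: "i \<in> nodes4 P" for n i
  proof -
    have N: "i \<in> nodes P" using i nodes4_subset by blast
    have S1: "S (n + 1) 1 = nodes4 P" using A3 i n unfolding assumption_A3_def by auto
    have n1: "n + 1 \<ge> 1" and w1: "1 \<in> {1..wbar}" using wbar by auto
    define q where "q = x (n + 1) 0 $ i"
    have qx: "q = x n wbar $ i" using x_carry[OF n] by (simp add: q_def)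
    have vw: "valid n wbar" "valid (n + 1) 0" using valid_all[OF n] valid_all[OF n1] by auto
    have qX: "q \<in> node_space P i" unfolding qx using Xprod_coord[OF x_in_Xprod[OF vw(1)] N] .
    have qR: "norm q \<le> R" unfolding qx
      using R n Finite_Cartesian_Product.norm_nth_le[of "x n wbar" i] by force
    have "\<exists>s\<in>subdifferential (node_space P i) (nodefun P i) q.
      conj_at (n + 1) 1 i (z (n + 1) 1 i) + ereal (x (n + 1) 1 \<bullet> (z (n + 1) (1 - 1) i - z (n + 1) 1 i))
        + ereal (real_of_ereal (nodefun P i q) - g (n + 1) (1 - 1) i q
                 - norm (s - z (n + 1) (1 - 1) i $ i) * norm (x (n + 1) 1 - x (n + 1) (1 - 1)))
      \<le> conj_at (n + 1) (1 - 1) i (z (n + 1) (1 - 1) i)"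
      by (rule subgradient_step(3)[OF n1 w1]) (use vw S1 i q_def in auto)
    then obtain s where s: "s \<in> subdifferential (node_space P i) (nodefun P i) q"
      and slack: "conj_at (n + 1) 1 i (z (n + 1) 1 i) + ereal (x (n + 1) 1 \<bullet> (z (n + 1) (1 - 1) i - z (n + 1) 1 i))
        + ereal (real_of_ereal (nodefun P i q) - g (n + 1) (1 - 1) i q
                 - norm (s - z (n + 1) (1 - 1) i $ i) * norm (x (n + 1) 1 - x (n + 1) (1 - 1)))
      \<le> conj_at (n + 1) (1 - 1) i (z (n + 1) (1 - 1) i)" by blast
    have fin0: "dual_finite (n + 1) (1 - 1)" using dual_finite_carry[OF n] by simp
    have iS: "i \<in> S (n + 1) 1" using S1 i by simp
    note ds = descent_slack(2)[OF n1 w1 fin0 iS slack]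
    have ge: "g (n + 1) 0 i q = g n wbar i q" using carry_facts(3)[OF n i qX] .
    have "norm (s - z (n + 1) 0 i $ i) \<le> norm s + norm (z n wbar i $ i)"
      using norm_triangle_ineq4[of s] carry_facts(1)[OF n N] by simp
    also have "\<dots> \<le> L'"
    proof -
      have "norm s \<le> \<bar>L i\<bar>" using L[OF i qX s qR] by simp
      also have "\<dots> \<le> (\<Sum>i\<in>nodes4 P. \<bar>L i\<bar>)" using i by (intro member_le_sum) auto
      finally have "norm s \<le> (\<Sum>i\<in>nodes4 P. \<bar>L i\<bar>)" .
      moreover have "norm (z n wbar i $ i) \<le> \<bar>B\<bar>"
      proof -
        have "norm (z n wbar i) \<le> B" using B n N by blast
        then show ?thesis using Finite_Cartesian_Product.norm_nth_le[of "z n wbar i" i] by linarith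
      qed
      ultimately show ?thesis unfolding L'_def by simp
    qed
    finally have "norm (s - z (n + 1) 0 i $ i) * norm (x (n + 1) 1 - x (n + 1) 0)
      \<le> L' * norm (x (n + 1) 1 - x (n + 1) 0)" by (intro mult_right_mono) auto
    moreover have "minorant_gap n i = real_of_ereal (nodefun P i q) - g (n + 1) 0 i q"
      unfolding minorant_gap_def qx[symmetric] ge ..
    moreover have "0 \<le> (norm (x (n + 1) 1 - x (n + 1) 0))\<^sup>2" by simp
    ultimately show ?thesis using ds[unfolded diff_self_eq_0] by linarith
  qed
  then show ?thesis using L'0 by blast
qed

section \<open>Recursive inequalities for the distance to the optimum\<close>

definition dual_gap :: "nat \<Rightarrow> real" where
  "dual_gap n = neg_dual n 0 + dual_max"

lemma dual_gap_decreasing: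
  assumes "n \<ge> 1" "dual_finite n 0"
  shows "0 \<le> dual_gap n" "dual_gap (n + 1) \<le> dual_gap n" "dual_finite (n + 1) 0"
  using neg_dual_ge_optimum[of n 0] neg_dual_antimono[OF assms, of 0 wbar] neg_dual_carry dual_finite_carry assms
  unfolding dual_gap_def by auto

lemma dual_gap_le_second:
  assumes "n \<ge> 2"
  shows "dual_gap n \<le> dual_gap 2"
  using assms
proof (induction n rule: dec_induct)
  case (step k)
  have "dual_finite k 0" using dual_finite_carry[of "k - 1"] step by simp
  then show ?case using dual_gap_decreasing(2)[of k] step by simp
qed simp

lemma sweep_bound:
  "\<exists>M>0. \<forall>n\<ge>1. dual_finite n 0 \<longrightarrow>
     dual_gap (n + 1) \<le> M * sqrt (real wbar) * sqrt (dual_gap n - dual_gap (n + 1)) + (\<Sum>i\<in>nodes4 P. minorant_gap n i)"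
proof -
  obtain M where M: "M > 0" "\<And>n. n \<ge> 1 \<Longrightarrow> neg_dual n wbar + dual_max \<le> M * travel n + (\<Sum>i\<in>nodes4 P. minorant_gap n i)"
    using comparison_with_optimizer by blast
  have "dual_gap (n + 1) \<le> (M * sqrt 2) * sqrt (real wbar) * sqrt (dual_gap n - dual_gap (n + 1)) + (\<Sum>i\<in>nodes4 P. minorant_gap n i)"
    if n: "n \<ge> 1" and fin: "dual_finite n 0" for n
  proof -
    have eq: "dual_gap n - dual_gap (n + 1) = neg_dual n 0 - neg_dual n wbar" using neg_dual_carry[OF n] by (simp add: dual_gap_def)
    have "M * travel n \<le> M * (sqrt (real wbar) * sqrt (2 * (dual_gap n - dual_gap (n + 1))))"
      unfolding eq using travel_le[OF n fin] M(1) by (intro mult_left_mono) auto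
    also have "\<dots> = (M * sqrt 2) * sqrt (real wbar) * sqrt (dual_gap n - dual_gap (n + 1))"
      unfolding real_sqrt_mult by (simp only: mult_ac)
    finally show ?thesis using M(2)[OF n] neg_dual_carry[OF n] by (simp add: dual_gap_def)
  qed
  then show ?thesis using M(1) by (intro exI[of _ "M * sqrt 2"]) auto
qed

text \<open>
  The errors of the minorants after one sweep are paid for by the first step of the next sweep, which is
  why two sweeps enter.
\<close>

lemma two_sweep_bound:
  "\<exists>K>0. \<forall>n\<ge>1. dual_finite n 0 \<longrightarrow> (dual_gap (n + 2))\<^sup>2 \<le> K * (dual_gap n - dual_gap (n + 2))"
proof -
  obtain M where M: "M > 0" "\<And>n. n \<ge> 1 \<Longrightarrow> dual_finite n 0 \<Longrightarrow>
     dual_gap (n + 1) \<le> M * sqrt (real wbar) * sqrt (dual_gap n - dual_gap (n + 1)) + (\<Sum>i\<in>nodes4 P. minorant_gap n i)"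
    using sweep_bound by blast
  obtain L where L: "L \<ge> 0" "\<And>n i. n \<ge> 1 \<Longrightarrow> i \<in> nodes4 P \<Longrightarrow>
     minorant_gap n i \<le> (neg_dual (n + 1) 0 - neg_dual (n + 1) 1) + L * norm (x (n + 1) 1 - x (n + 1) 0)"
    using minorant_gap_le_descent by blast
  define G where "G = sqrt (dual_gap 2) + L * sqrt 2"
  define A where "A = M * sqrt (real wbar) + real (card (nodes4 P)) * G"
  have "(dual_gap (n + 2))\<^sup>2 \<le> (A\<^sup>2 + 1) * (dual_gap n - dual_gap (n + 2))" if n: "n \<ge> 1" and fin: "dual_finite n 0" for n
  proof -
    note d0 = dual_gap_decreasing[OF n fin]
    have n1: "n + 1 \<ge> 1" by simp
    note d1 = dual_gap_decreasing[OF n1 d0(3)]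
    have n2: "n + 2 \<ge> 1" by simp
    have "n + 1 + 1 = n + 2" by simp
    note d1 = d1[unfolded this]
    note d2 = dual_gap_decreasing[OF n2 d1(3)]
    define E where "E = dual_gap n - dual_gap (n + 2)"
    define \<delta> where "\<delta> = neg_dual (n + 1) 0 - neg_dual (n + 1) 1"
    define t where "t = norm (x (n + 1) 1 - x (n + 1) 0)"
    have w1: "1 \<in> {1..wbar}" using wbar by auto
    have t: "t\<^sup>2 \<le> 2 * \<delta>"
      using descent_step(2)[OF n1 w1] d0(3) by (simp add: t_def \<delta>_def)
    have \<delta>0: "0 \<le> \<delta>" using t zero_le_power2[of t] by linarith
    have "neg_dual (n + 1) wbar \<le> neg_dual (n + 1) 1"
      using neg_dual_antimono[OF n1 d0(3), of 1 wbar] wbar by simp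
    then have \<delta>1: "\<delta> \<le> dual_gap (n + 1) - dual_gap (n + 2)"
      using neg_dual_carry[OF n1] by (simp add: \<delta>_def dual_gap_def)
    have \<delta>E: "\<delta> \<le> E" using \<delta>1 d0(2) by (simp add: E_def)
    have \<delta>G: "\<delta> \<le> dual_gap 2" using \<delta>1 d2(1) dual_gap_le_second[of "n + 1"] n by simp
    \<comment> \<open>One factor \<open>sqrt \<delta>\<close> is traded for a constant, as \<open>dual_gap\<close> is bounded from the second sweep on.\<close>
    have "\<delta> = sqrt \<delta> * sqrt \<delta>" using \<delta>0 by simp
    also have "\<dots> \<le> sqrt (dual_gap 2) * sqrt E" using \<delta>E \<delta>G \<delta>0 by (intro mult_mono) auto
    finally have a: "\<delta> \<le> sqrt (dual_gap 2) * sqrt E" .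
    have "t \<le> sqrt (2 * \<delta>)" using t by (rule real_le_rsqrt)
    also have "\<dots> \<le> sqrt 2 * sqrt E" using \<delta>E by (simp add: real_sqrt_mult)
    finally have "L * t \<le> L * (sqrt 2 * sqrt E)" using L(1) by (rule mult_left_mono)
    then have "minorant_gap n i \<le> G * sqrt E" if "i \<in> nodes4 P" for i
      using L(2)[OF n that] a unfolding \<delta>_def[symmetric] t_def[symmetric] G_def
      by (simp add: algebra_simps)
    then have "(\<Sum>i\<in>nodes4 P. minorant_gap n i) \<le> (\<Sum>i\<in>nodes4 P. G * sqrt E)" by (rule sum_mono)
    moreover have "M * sqrt (real wbar) * sqrt (dual_gap n - dual_gap (n + 1)) \<le> M * sqrt (real wbar) * sqrt E"
      using M(1) d1(2) by (intro mult_left_mono) (auto simp: E_def)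
    ultimately have "dual_gap (n + 1) \<le> A * sqrt E"
      using M(2)[OF n fin] by (simp add: A_def algebra_simps)
    then have "dual_gap (n + 2) \<le> A * sqrt E" using d1(2) by simp
    then have "(dual_gap (n + 2))\<^sup>2 \<le> (A * sqrt E)\<^sup>2" using d2(1) by (intro power_mono)
    also have "\<dots> = A\<^sup>2 * E" using \<delta>E \<delta>0 by (simp add: power_mult_distrib)
    also have "\<dots> \<le> (A\<^sup>2 + 1) * E" using \<delta>E \<delta>0 by (simp add: algebra_simps)
    finally show ?thesis by (simp add: E_def)
  qed
  moreover have "A\<^sup>2 + 1 > 0" using zero_le_power2[of A] by linarith
  ultimately show ?thesis by blast
qed

end

section \<open>Convergence rates of the dual values\<close>

theorem theorem5p2:
  fixes P :: "('k::finite, 'a::euclidean_space) problem"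
    and wbar :: nat
    and Creg :: real
    and z :: "nat \<Rightarrow> nat \<Rightarrow> 'k \<Rightarrow> 'a ^ 'k"
    and g :: "nat \<Rightarrow> nat \<Rightarrow> 'k \<Rightarrow> 'a \<Rightarrow> real"
    and S :: "nat \<Rightarrow> nat \<Rightarrow> 'k set"
    and En :: "nat \<Rightarrow> 'k set"
    and zstar :: "'k \<Rightarrow> 'a ^ 'k"
    and h :: "nat \<Rightarrow> ereal"
  assumes data: "problem_data P"
    and wbar: "wbar > 0"
    and Creg: "regularity_const P Creg"
    and run: "dykstra_run P wbar Creg z g S En"
    and feasible: "feasible P"
    and En_eq: "\<And>n. n \<ge> 1 \<Longrightarrow> En n = (\<Union>w\<in>{1..wbar}. S n w) \<inter> edges P"
    and cover: "\<And>n. n \<ge> 1 \<Longrightarrow> nodes P \<subseteq> (\<Union>w\<in>{1..wbar}. S n w)"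
    and A1: "assumption_A1 P wbar z g S"
    and A2: "assumption_A2 P wbar S"
    and A3: "assumption_A3 P S"
    and optimizer: "dual_optimizer P zstar"
    and iterates_bounded:
      "bounded {z n w \<alpha> | n w \<alpha>. n \<ge> 1 \<and> w \<in> {1..wbar} \<and> \<alpha> \<in> nodes P \<union> edges P}"
    and h_def: "\<And>n. h n = - dualn P g n 0 (z n 0) - (- dual P zstar)"
  shows "(\<exists>\<gamma>>0. \<forall>n\<ge>1. h (n + 2) \<le> h n - ereal \<gamma> * h (n + 2) ^ 4)
    \<and> ereal_bigo h (\<lambda>n. 1 / real n powr (1 / 3))
    \<and> (nodes4 P = {} \<longrightarrow>
         (\<exists>C1>0. \<forall>n\<ge>1. h (n + 1) \<le> ereal (C1 * sqrt (real wbar)) * ereal_sqrt (h n - h (n + 1)))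
         \<and> ereal_bigo h (\<lambda>n. 1 / real n))"
proof -
  interpret dykstra P wbar Creg z g S En zstar
    using data wbar Creg run feasible En_eq cover A2 A3 optimizer iterates_bounded
    by (rule dykstra.intro)
  have h_fin: "h n = ereal (dual_gap n)" if "dual_finite n 0" for n
    unfolding h_def dualn_fin[OF that] dual_zstar by (simp add: dual_gap_def)
  have h_inf: "h n = \<infinity>" if "\<not> dual_finite n 0" for n
    unfolding h_def dualn_not_fin[OF that] dual_zstar by simp
  have finS: "dual_finite (n + 1) 0" if "n \<ge> 1" for n using dual_finite_carry[OF that] .
  have fin2: "dual_finite n 0" if "n \<ge> 2" for n using finS[of "n - 1"] that by simp
  have h2: "h n = ereal (dual_gap n)" if "n \<ge> 2" for n using h_fin[OF fin2[OF that]] .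
  have gap0: "0 \<le> dual_gap n" if "n \<ge> 2" for n using dual_gap_decreasing(1)[of n] fin2[OF that] that by simp
  obtain K where K: "K > 0" "\<And>n. n \<ge> 1 \<Longrightarrow> dual_finite n 0 \<Longrightarrow> (dual_gap (n + 2))\<^sup>2 \<le> K * (dual_gap n - dual_gap (n + 2))"
    using two_sweep_bound by blast

  have quartic: "\<exists>\<gamma>>0. \<forall>n\<ge>1. h (n + 2) \<le> h n - ereal \<gamma> * h (n + 2) ^ 4"
  proof -
    define G where "G = (dual_gap 2)\<^sup>2 + 1"
    define \<gamma> where "\<gamma> = 1 / (G * K)"
    have G: "G > 0" unfolding G_def by (simp add: add_nonneg_pos)
    have \<gamma>: "\<gamma> > 0" using G K(1) by (simp add: \<gamma>_def)
    have "h (n + 2) \<le> h n - ereal \<gamma> * h (n + 2) ^ 4" if n: "n \<ge> 1" for n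
    proof (cases "dual_finite n 0")
      case True
      have "dual_gap (n + 2) \<le> dual_gap 2" using dual_gap_le_second[of "n + 2"] by simp
      then have "(dual_gap (n + 2))\<^sup>2 \<le> G"
        using power_mono[OF _ gap0[of "n + 2"], of "dual_gap 2" 2] by (simp add: G_def)
      then have "(dual_gap (n + 2))\<^sup>2 * (dual_gap (n + 2))\<^sup>2 \<le> G * (K * (dual_gap n - dual_gap (n + 2)))"
        using K(2)[OF n True] G by (intro mult_mono) auto
      then have "dual_gap (n + 2) ^ 4 \<le> G * K * (dual_gap n - dual_gap (n + 2))"
        by (simp add: power2_eq_square power4_eq_xxxx mult.assoc)
      then have "\<gamma> * dual_gap (n + 2) ^ 4 \<le> dual_gap n - dual_gap (n + 2)"
        using G K(1) by (simp add: \<gamma>_def field_simps)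
      then show ?thesis using h_fin[OF True] h2[of "n + 2"] by simp
    qed (use h_inf h2[of "n + 2"] in simp)
    then show ?thesis using \<gamma> by blast
  qed

  have "dual_gap \<in> O(\<lambda>n. 1 / real n)"
  proof (rule two_step_quadratic_decrease_rate)
    show "1 / K > 0" using K(1) by simp
    fix n :: nat assume n: "n \<ge> 2"
    show "0 \<le> dual_gap n" using gap0[OF n] .
    have "(dual_gap (n + 2))\<^sup>2 \<le> K * (dual_gap n - dual_gap (n + 2))" using K(2) fin2[OF n] n by simp
    then show "dual_gap (n + 2) \<le> dual_gap n - 1 / K * (dual_gap (n + 2))\<^sup>2" using K(1) by (simp add: field_simps)
  qed
  moreover have evh: "\<forall>\<^sub>F n in sequentially. dual_gap n = real_of_ereal (h n)"
    using eventually_ge_at_top[of 2] by eventually_elim (simp add: h2)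
  ultimately have linO: "(\<lambda>n. real_of_ereal (h n)) \<in> O(\<lambda>n. 1 / real n)"
    using landau_o.big.in_cong[OF evh] by simp
  have evfin: "\<forall>\<^sub>F n in sequentially. \<bar>h n\<bar> \<noteq> \<infinity>"
    using eventually_ge_at_top[of 2] by eventually_elim (simp add: h2)
  have linear_rate: "ereal_bigo h (\<lambda>n. 1 / real n)"
    unfolding ereal_bigo_def using evfin linO by blast
  have "(\<lambda>n. 1 / real n) \<in> O(\<lambda>n. 1 / real n powr (1 / 3))"
  proof (rule bigoI[of _ 1])
    show "\<forall>\<^sub>F n in sequentially. norm (1 / real n) \<le> 1 * norm (1 / real n powr (1 / 3))"
      using eventually_ge_at_top[of 1]
    proof eventually_elim
      case (elim n)
      have "real n powr (1 / 3) \<le> real n powr 1" using elim by (intro powr_mono) auto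
      then show ?case using elim by (simp add: frac_le)
    qed
  qed
  then have cubic_rate: "ereal_bigo h (\<lambda>n. 1 / real n powr (1 / 3))"
    unfolding ereal_bigo_def using evfin landau_o.big_trans[OF linO] by blast

  have proximal: "\<exists>C1>0. \<forall>n\<ge>1. h (n + 1) \<le> ereal (C1 * sqrt (real wbar)) * ereal_sqrt (h n - h (n + 1))"
    if V4: "nodes4 P = {}"
  proof -
    obtain M where M: "M > 0" "\<And>n. n \<ge> 1 \<Longrightarrow> dual_finite n 0 \<Longrightarrow>
       dual_gap (n + 1) \<le> M * sqrt (real wbar) * sqrt (dual_gap n - dual_gap (n + 1)) + (\<Sum>i\<in>nodes4 P. minorant_gap n i)"
      using sweep_bound by blast
    have "h (n + 1) \<le> ereal (M * sqrt (real wbar)) * ereal_sqrt (h n - h (n + 1))" if n: "n \<ge> 1" for n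
    proof (cases "dual_finite n 0")
      case True
      then show ?thesis using M(2)[OF n True] h_fin[OF True] h2[of "n + 1"] n V4 by (simp add: ereal_sqrt_def)
    next
      case False
      have "M \<noteq> 0" "wbar \<noteq> 0" using M(1) wbar by auto
      moreover have "M * sqrt (real wbar) > 0" using M(1) wbar by simp
      ultimately have rhs: "ereal (M * sqrt (real wbar)) * ereal_sqrt (h n - h (n + 1)) = \<infinity>"
        using h_inf[OF False] h2[of "n + 1"] n by (simp add: ereal_sqrt_def)
      show ?thesis unfolding rhs by simp
    qed
    then show ?thesis using M(1) by blast
  qed
  show ?thesis using quartic cubic_rate proximal linear_rate by blast
qed

end
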